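(* Let $P,\sigma>0$, let $L\ge2$ be an integer, let $\mathrm{snr}=P/\sigma^2$, and define $$R_{\mathrm{x},L-1}(\mathrm{snr})=\frac12\left(\ln\frac{\sqrt{L^2+\mathrm{snr}^2-2\,\mathrm{snr}(L-2)}+L+\mathrm{snr}}{2L}+\frac1{L-1}\ln\frac{\sqrt{L^2+\mathrm{snr}^2-2\,\mathrm{snr}(L-2)}+L-\mathrm{snr}}{2L}\right).$$ Then for every $0\le R\le R_{\mathrm{x},L-1}(\mathrm{snr})$ there exist codes of rate $R$ for the AWGN channel with input constraint $P$ and noise variance $\sigma^2$ whose error exponent $E_{L-1}(R,\mathrm{snr})=\lim_{n\to\infty}-\frac1n\ln P_{\mathrm{e},\mathrm{avg},L-1}^{\mathrm{ML}}$ under $(L-1)$-list-decoding satisfies $$E_{L-1}(R,\mathrm{snr})\ge\frac{\mathrm{snr}(Lt-1)}{2Lt},$$ where $t$ is the unique solution of $(Lt-1)e^{2R}=(L-1)t^{\frac{L}{L-1}}$ in $t\in[1/L,1]$.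
   Context: The AWGN channel with input constraint $P$ and noise variance $\sigma^2$ maps $x\in\mathbb{R}^n$ with $\|x\|_2\le\sqrt{nP}$ to $x+\mathbf{g}$, $\mathbf{g}\sim\mathcal{N}(0,\sigma^2I_n)$. A code is a finite set $\mathcal{C}=\{x_1,\dots,x_M\}\subset\mathbb{R}^n$ with $\|x_i\|_2\le\sqrt{nP}$ for all $i$; its rate is $\frac1n\ln M$. The maximum-likelihood (ML) $(L-1)$-list-decoder outputs the $L-1$ codewords nearest to the channel output, and an error occurs if the transmitted codeword is not in the list: $$P_{\mathrm{e},L-1}^{\mathrm{ML}}(i,\mathcal{C})=\Pr\left[\exists\text{ distinct } i_1,\dots,i_{L-1}\in\{1,\dots,M\}\setminus\{i\}\ \forall j:\ \|x_{i_j}-(x_i+\mathbf{g})\|_2<\|\mathbf{g}\|_2\right],$$ $P_{\mathrm{e},\mathrm{avg},L-1}^{\mathrm{ML}}(\mathcal{C})=\frac1M\sum_{i=1}^M P_{\mathrm{e},L-1}^{\mathrm{ML}}(i,\mathcal{C})$. "Codes of rate $R$" means a sequence of codes along an increasing sequence of blocklengths $n$ whose rates tend to $R$; limits are along this sequence. *)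

theory Defs
  imports "HOL-Probability.Probability"
begin

(* Vectors of real^n, for n varying along a sequence, are functions nat => real on the index
   set {..<n}; codewords are extensional, so that equality of codewords and the cardinality of
   a code are those of real^n.  The Euclidean norm is L2_set _ {..<n}. *)

definition real_space :: "nat \<Rightarrow> (nat \<Rightarrow> real) set" where
  "real_space n = {..<n} \<rightarrow>\<^sub>E UNIV"

definition awgn_code :: "nat \<Rightarrow> real \<Rightarrow> (nat \<Rightarrow> real) set \<Rightarrow> bool" where
  "awgn_code n P C \<longleftrightarrow> finite C \<and> C \<noteq> {} \<and> C \<subseteq> real_space n \<and>
     (\<forall>x\<in>C. L2_set x {..<n} \<le> sqrt (real n * P))"

definition code_rate :: "nat \<Rightarrow> (nat \<Rightarrow> real) set \<Rightarrow> real" where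
  "code_rate n C = ln (real (card C)) / real n"

definition gaussian_noise :: "nat \<Rightarrow> real \<Rightarrow> (nat \<Rightarrow> real) measure" where
  "gaussian_noise n \<sigma> = Pi\<^sub>M {..<n} (\<lambda>_. density lborel (\<lambda>u. ennreal (normal_density 0 \<sigma> u)))"

(* Distinct codewords stand for distinct indices, the code being a set. *)

definition list_error_event ::
  "nat \<Rightarrow> nat \<Rightarrow> (nat \<Rightarrow> real) set \<Rightarrow> (nat \<Rightarrow> real) \<Rightarrow> (nat \<Rightarrow> real) \<Rightarrow> bool" where
  "list_error_event n l C x g \<longleftrightarrow>
     (\<exists>ys. length ys = l \<and> distinct ys \<and> set ys \<subseteq> C - {x} \<and>
        (\<forall>y\<in>set ys. L2_set (\<lambda>k. y k - (x k + g k)) {..<n} < L2_set g {..<n}))"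

definition list_error_prob ::
  "nat \<Rightarrow> real \<Rightarrow> nat \<Rightarrow> (nat \<Rightarrow> real) set \<Rightarrow> (nat \<Rightarrow> real) \<Rightarrow> real" where
  "list_error_prob n \<sigma> l C x =
     measure (gaussian_noise n \<sigma>)
       {g \<in> space (gaussian_noise n \<sigma>). list_error_event n l C x g}"

definition avg_list_error_prob ::
  "nat \<Rightarrow> real \<Rightarrow> nat \<Rightarrow> (nat \<Rightarrow> real) set \<Rightarrow> real" where
  "avg_list_error_prob n \<sigma> l C = (\<Sum>x\<in>C. list_error_prob n \<sigma> l C x) / real (card C)"

(* The value -(1/n) ln p, with -ln 0 = \<infinity> (whereas ln 0 = 0 on type real). *)

definition normalized_neg_ln :: "nat \<Rightarrow> real \<Rightarrow> ereal" where
  "normalized_neg_ln n p = (if p = 0 then \<infinity> else ereal (- (ln p / real n)))"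

definition codes_of_rate ::
  "real \<Rightarrow> real \<Rightarrow> (nat \<Rightarrow> nat) \<Rightarrow> (nat \<Rightarrow> (nat \<Rightarrow> real) set) \<Rightarrow> bool" where
  "codes_of_rate P R n C \<longleftrightarrow> strict_mono n \<and> (\<forall>k. 0 < n k) \<and> (\<forall>k. awgn_code (n k) P (C k)) \<and>
     (\<lambda>k. code_rate (n k) (C k)) \<longlonglongrightarrow> R"

definition has_error_exponent ::
  "real \<Rightarrow> nat \<Rightarrow> (nat \<Rightarrow> nat) \<Rightarrow> (nat \<Rightarrow> (nat \<Rightarrow> real) set) \<Rightarrow> ereal \<Rightarrow> bool" where
  "has_error_exponent \<sigma> l n C E \<longleftrightarrow>
     (\<lambda>k. normalized_neg_ln (n k) (avg_list_error_prob (n k) \<sigma> l (C k))) \<longlonglongrightarrow> E"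

definition rate_x :: "nat \<Rightarrow> real \<Rightarrow> real" where
  "rate_x L snr =
     1/2 * (ln ((sqrt ((real L)\<^sup>2 + snr\<^sup>2 - 2 * snr * (real L - 2)) + real L + snr) / (2 * real L))
       + 1 / (real L - 1) *
         ln ((sqrt ((real L)\<^sup>2 + snr\<^sup>2 - 2 * snr * (real L - 2)) + real L - snr) / (2 * real L)))"

definition exponent_param :: "nat \<Rightarrow> real \<Rightarrow> real \<Rightarrow> bool" where
  "exponent_param L R t \<longleftrightarrow> t \<in> {1 / real L..1} \<and>
     (real L * t - 1) * exp (2 * R) = (real L - 1) * t powr (real L / (real L - 1))"

end

theory Submission
  imports Defs
begin

text \<open>
The codes come from random coding with expurgation. The error probability of a codeword is at most the
sum, over all lists of $L - 1$ other codewords, of $\exp(-r^2/(2\sigma^2))$, where $r^2$ is the average squared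
radius (mean squared distance to the centroid) of the $L$ codewords involved
(\<open>list_error_prob_le_sum_exp_spread\<close>). So a code is wanted in which hardly any $L$-tuple is clustered.

Fix $\rho \ge 1$ and $\beta = 1/(2\sigma^2\rho)$. The sum is at most the $\rho$-th power of
$\sum \exp(-\beta r^2)$, and this second sum has a computable expectation over a Gaussian
codebook: the average radius splits over the coordinates, and in one coordinate the exponential of a
variance is a Gaussian mixture of products, so that everything reduces to one-dimensional Gaussian
integrals (\<open>nn_integral_column_weight\<close>). Codewords are kept only in a thin shell just below the
allowed norm; an exponential tilt in the norm replaces the indicator of the shell. A codebook for which
the clustering sum is not much larger than its expectation exists (\<open>random_codebook\<close>), and removing
at most half of the codewords, the worst ones, bounds the sum for each single codeword (\<open>expurgated_code\<close>).

The outcome is the exponent $\rho\,(-\ln\gamma - (L-1)R)$, where $\gamma$ is the one-coordinate expectation.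
Optimizing over the tilt and over $\rho$ leads to the parametrization by $t$, with
$\rho = \mathrm{snr}\,(Lt-1)/(L^2 t(1-t))$. The condition $\rho \ge 1$ is exactly the condition that the rate does not
exceed the critical one (\<open>expurgation_parameter_ge_1\<close>). Finally the shell is made arbitrarily thin,
and a diagonal sequence with a convergent subsequence yields codes that have an exponent
(\<open>exponent_achieved_of_eventually\<close>).
\<close>

section \<open>Gaussian integrals\<close>

abbreviation gauss :: "real \<Rightarrow> real measure" where
  "gauss \<sigma> \<equiv> density lborel (\<lambda>u. ennreal (normal_density 0 \<sigma> u))"

lemma nn_integral_exp_quadratic:
  fixes \<kappa> b :: real
  assumes "\<kappa> > 0"
  shows "(\<integral>\<^sup>+y. ennreal (exp (b * y - \<kappa> * y\<^sup>2)) \<partial>lborel) = ennreal (sqrt (pi / \<kappa>) * exp (b\<^sup>2 / (4 * \<kappa>)))"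
proof -
  define s where "s = 1 / sqrt (2 * \<kappa>)"
  define m where "m = b / (2 * \<kappa>)"
  have s: "s > 0" "s\<^sup>2 = 1 / (2 * \<kappa>)"
    using assms by (auto simp: s_def power_divide)
  have eq: "exp (b * y - \<kappa> * y\<^sup>2) = sqrt (pi / \<kappa>) * exp (b\<^sup>2 / (4 * \<kappa>)) * normal_density m s y" for y
  proof -
    have "- (y - m)\<^sup>2 / (2 * s\<^sup>2) = - \<kappa> * (y - m)\<^sup>2"
      unfolding s(2) using assms by simp
    moreover have "b * y - \<kappa> * y\<^sup>2 = b\<^sup>2 / (4 * \<kappa>) + - \<kappa> * (y - m)\<^sup>2"
      using assms by (simp add: m_def field_simps power2_eq_square)
    ultimately have "b * y - \<kappa> * y\<^sup>2 = b\<^sup>2 / (4 * \<kappa>) + (- (y - m)\<^sup>2 / (2 * s\<^sup>2))"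
      by simp
    then show ?thesis
      using assms by (simp add: normal_density_def s real_sqrt_divide flip: exp_add)
  qed
  interpret prob_space "density lborel (normal_density m s)"
    using s(1) by (rule prob_space_normal_density)
  have one: "(\<integral>\<^sup>+y. ennreal (normal_density m s y) \<partial>lborel) = 1"
    using emeasure_space_1 by (simp add: emeasure_density)
  have "(\<integral>\<^sup>+y. ennreal (exp (b * y - \<kappa> * y\<^sup>2)) \<partial>lborel)
      = (\<integral>\<^sup>+y. ennreal (sqrt (pi / \<kappa>) * exp (b\<^sup>2 / (4 * \<kappa>))) * ennreal (normal_density m s y) \<partial>lborel)"
    unfolding eq using assms by (intro nn_integral_cong) (simp add: ennreal_mult')
  also have "\<dots> = ennreal (sqrt (pi / \<kappa>) * exp (b\<^sup>2 / (4 * \<kappa>))) * (\<integral>\<^sup>+y. ennreal (normal_density m s y) \<partial>lborel)"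
    by (intro nn_integral_cmult) simp
  finally show ?thesis by (simp add: one)
qed

lemma nn_integral_gauss_exp_quadratic:
  fixes \<sigma> a b :: real
  assumes "\<sigma> > 0" and "2 * a * \<sigma>\<^sup>2 < 1"
  shows "(\<integral>\<^sup>+x. ennreal (exp (a * x\<^sup>2 + b * x)) \<partial>gauss \<sigma>)
    = ennreal (exp (b\<^sup>2 * \<sigma>\<^sup>2 / (2 * (1 - 2 * a * \<sigma>\<^sup>2))) / sqrt (1 - 2 * a * \<sigma>\<^sup>2))"
proof -
  define \<kappa> where "\<kappa> = (1 - 2 * a * \<sigma>\<^sup>2) / (2 * \<sigma>\<^sup>2)"
  have \<kappa>: "\<kappa> > 0" using assms by (simp add: \<kappa>_def)
  have eq: "normal_density 0 \<sigma> x * exp (a * x\<^sup>2 + b * x) = 1 / sqrt (2 * pi * \<sigma>\<^sup>2) * exp (b * x - \<kappa> * x\<^sup>2)" for x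
  proof -
    have "b * x - \<kappa> * x\<^sup>2 = - x\<^sup>2 / (2 * \<sigma>\<^sup>2) + (a * x\<^sup>2 + b * x)"
      using assms(1) by (simp add: \<kappa>_def field_simps)
    then show ?thesis unfolding normal_density_def by (simp flip: exp_add)
  qed
  have "(\<integral>\<^sup>+x. ennreal (exp (a * x\<^sup>2 + b * x)) \<partial>gauss \<sigma>)
      = (\<integral>\<^sup>+x. ennreal (normal_density 0 \<sigma> x * exp (a * x\<^sup>2 + b * x)) \<partial>lborel)"
    by (subst nn_integral_density) (auto simp: ennreal_mult')
  also have "\<dots> = (\<integral>\<^sup>+x. ennreal (1 / sqrt (2 * pi * \<sigma>\<^sup>2)) * ennreal (exp (b * x - \<kappa> * x\<^sup>2)) \<partial>lborel)"
    unfolding eq by (intro nn_integral_cong, subst ennreal_mult'[symmetric]) simp_all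
  also have "\<dots> = ennreal (1 / sqrt (2 * pi * \<sigma>\<^sup>2)) * ennreal (sqrt (pi / \<kappa>) * exp (b\<^sup>2 / (4 * \<kappa>)))"
    by (subst nn_integral_cmult) (auto simp: nn_integral_exp_quadratic[OF \<kappa>])
  also have "\<dots> = ennreal (1 / sqrt (2 * pi * \<sigma>\<^sup>2) * (sqrt (pi / \<kappa>) * exp (b\<^sup>2 / (4 * \<kappa>))))"
    by (subst ennreal_mult') auto
  also have "1 / sqrt (2 * pi * \<sigma>\<^sup>2) * (sqrt (pi / \<kappa>) * exp (b\<^sup>2 / (4 * \<kappa>)))
      = exp (b\<^sup>2 * \<sigma>\<^sup>2 / (2 * (1 - 2 * a * \<sigma>\<^sup>2))) / sqrt (1 - 2 * a * \<sigma>\<^sup>2)"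
  proof -
    have "b\<^sup>2 / (4 * \<kappa>) = b\<^sup>2 * \<sigma>\<^sup>2 / (2 * (1 - 2 * a * \<sigma>\<^sup>2))"
      using assms by (simp add: \<kappa>_def field_simps)
    moreover have "1 / sqrt (2 * pi * \<sigma>\<^sup>2) * sqrt (pi / \<kappa>) = 1 / sqrt (1 - 2 * a * \<sigma>\<^sup>2)"
      using assms by (simp add: \<kappa>_def real_sqrt_divide real_sqrt_mult)
    ultimately show ?thesis by (simp only: mult.assoc[symmetric]) simp
  qed
  finally show ?thesis .
qed

lemma prob_space_gauss: "\<sigma> > 0 \<Longrightarrow> prob_space (gauss \<sigma>)"
  by (rule prob_space_normal_density)

lemma nn_integral_PiM_prod:
  fixes N :: "'b measure" and f :: "'a \<Rightarrow> 'b \<Rightarrow> real"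
  assumes "prob_space N" and "finite I"
    and "\<And>i. i \<in> I \<Longrightarrow> f i \<in> borel_measurable N"
    and "\<And>i x. i \<in> I \<Longrightarrow> f i x \<ge> 0"
  shows "(\<integral>\<^sup>+x. ennreal (\<Prod>i\<in>I. f i (x i)) \<partial>PiM I (\<lambda>_. N)) = (\<Prod>i\<in>I. \<integral>\<^sup>+x. ennreal (f i x) \<partial>N)"
proof -
  interpret N: prob_space N by fact
  interpret product_sigma_finite "\<lambda>_::'a. N" by unfold_locales
  have "(\<integral>\<^sup>+x. ennreal (\<Prod>i\<in>I. f i (x i)) \<partial>PiM I (\<lambda>_. N)) = (\<integral>\<^sup>+x. (\<Prod>i\<in>I. ennreal (f i (x i))) \<partial>PiM I (\<lambda>_. N))"
    using assms(4) by (simp add: prod_ennreal)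
  also have "\<dots> = (\<Prod>i\<in>I. \<integral>\<^sup>+x. ennreal (f i x) \<partial>N)"
    using assms by (intro product_nn_integral_prod) auto
  finally show ?thesis .
qed

text \<open>The population variance of a finite family of reals. For codewords $x_i$, $i \in I$, the sum over the
coordinates of the variances of that coordinate is the average squared radius
$\frac{1}{|I|}\sum_{i \in I} \|x_i - \bar x\|^2$, where $\bar x$ is the centroid.\<close>
definition spread :: "'a set \<Rightarrow> ('a \<Rightarrow> real) \<Rightarrow> real" where
  "spread I z = (\<Sum>i\<in>I. (z i)\<^sup>2) / card I - ((\<Sum>i\<in>I. z i) / card I)\<^sup>2"

text \<open>Completing the square in $\sum_i (y - z_i)^2 = |I| (y - \bar z)^2 + |I| \cdot \mbox{variance}$ and integrating
over the centre $y$. This linearization replaces a quadratic form that couples the $z_i$ by a mixture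
of products, so that independent $z_i$ can be averaged one at a time.\<close>
lemma exp_spread_eq_nn_integral:
  assumes "\<beta> > 0" and "finite I" and "I \<noteq> {}"
  shows "ennreal (exp (- \<beta> * spread I z))
    = ennreal (sqrt (\<beta> / pi)) * (\<integral>\<^sup>+y. ennreal (exp (- (\<beta> / card I) * (\<Sum>i\<in>I. (y - z i)\<^sup>2))) \<partial>lborel)"
proof -
  define L where "L = real (card I)"
  have L: "L > 0" using assms by (simp add: L_def card_gt_0_iff)
  define m where "m = (\<Sum>i\<in>I. z i) / L"
  define c where "c = \<beta> / L * (\<Sum>i\<in>I. (z i)\<^sup>2)"
  have eq: "- (\<beta> / L) * (\<Sum>i\<in>I. (y - z i)\<^sup>2) = - c + ((2 * \<beta> * m) * y - \<beta> * y\<^sup>2)" for y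
  proof -
    have sq: "(\<Sum>i\<in>I. (y - z i)\<^sup>2) = L * y\<^sup>2 + (\<Sum>i\<in>I. (z i)\<^sup>2) - 2 * y * (\<Sum>i\<in>I. z i)"
      by (simp add: power2_diff sum.distrib sum_subtractf L_def sum_distrib_left)
    show ?thesis
      unfolding sq using L by (simp add: m_def c_def field_simps)
  qed
  have "(\<integral>\<^sup>+y. ennreal (exp (- (\<beta> / L) * (\<Sum>i\<in>I. (y - z i)\<^sup>2))) \<partial>lborel)
      = (\<integral>\<^sup>+y. ennreal (exp (- c)) * ennreal (exp ((2 * \<beta> * m) * y - \<beta> * y\<^sup>2)) \<partial>lborel)"
    unfolding eq exp_add by (simp add: ennreal_mult')
  also have "\<dots> = ennreal (exp (- c)) * ennreal (sqrt (pi / \<beta>) * exp ((2 * \<beta> * m)\<^sup>2 / (4 * \<beta>)))"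
    by (subst nn_integral_cmult) (simp_all add: nn_integral_exp_quadratic[OF assms(1)])
  finally have "ennreal (sqrt (\<beta> / pi)) * (\<integral>\<^sup>+y. ennreal (exp (- (\<beta> / L) * (\<Sum>i\<in>I. (y - z i)\<^sup>2))) \<partial>lborel)
      = ennreal (sqrt (\<beta> / pi) * (exp (- c) * (sqrt (pi / \<beta>) * exp ((2 * \<beta> * m)\<^sup>2 / (4 * \<beta>)))))"
    using assms(1) by (simp add: ennreal_mult')
  also have "sqrt (\<beta> / pi) * (exp (- c) * (sqrt (pi / \<beta>) * exp ((2 * \<beta> * m)\<^sup>2 / (4 * \<beta>))))
      = exp (- c + (2 * \<beta> * m)\<^sup>2 / (4 * \<beta>))"
    using assms(1) by (simp add: real_sqrt_divide flip: exp_add)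
  also have "- c + (2 * \<beta> * m)\<^sup>2 / (4 * \<beta>) = - \<beta> * spread I z"
    using assms(1) L unfolding spread_def c_def m_def L_def[symmetric]
    by (simp add: field_simps power2_eq_square)
  finally show ?thesis by (simp add: L_def)
qed

text \<open>The weight combines two factors: $\exp(-\beta \cdot \mbox{variance})$ penalizes clustered tuples, and the tilt
with parameter $s$ will dominate the indicator that every codeword has squared norm at least $n q$.
Without the tilt, the expectation would be dominated by codewords that are atypically short.
Linearize the variance, exchange the integrals and integrate one Gaussian variable at a time.
In matrix terms the exponent has eigenvalue $s$ on the diagonal direction
and $s - \beta / |I|$ on its orthogonal complement, which explains the two square roots.\<close>
lemma nn_integral_column_weight:
  fixes \<sigma> \<beta> s q :: real and I J :: "'a set"
  assumes "\<sigma> > 0" and "\<beta> > 0" and "2 * s * \<sigma>\<^sup>2 < 1"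
    and "finite J" and "I \<subseteq> J" and "I \<noteq> {}"
  shows "(\<integral>\<^sup>+z. ennreal (exp (- \<beta> * spread I z + s * (\<Sum>i\<in>I. (z i)\<^sup>2 - q))) \<partial>PiM J (\<lambda>_. gauss \<sigma>))
    = ennreal (exp (- (card I * s * q)) / (sqrt (1 - 2 * s * \<sigma>\<^sup>2) *
        sqrt (1 - 2 * s * \<sigma>\<^sup>2 + 2 * \<beta> * \<sigma>\<^sup>2 / card I) ^ (card I - 1)))"
proof -
  define L where "L = card I"
  have finI: "finite I" using assms finite_subset by blast
  have L: "L > 0" using assms finI by (simp add: L_def card_gt_0_iff)
  define u where "u = 1 - 2 * s * \<sigma>\<^sup>2"
  define v where "v = u + 2 * \<beta> * \<sigma>\<^sup>2 / L"
  have u: "u > 0" using assms by (simp add: u_def)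
  have v: "v > 0" using u assms L by (simp add: v_def add_pos_pos)
  interpret N: prob_space "gauss \<sigma>" using assms(1) by (rule prob_space_gauss)
  interpret PN: product_sigma_finite "\<lambda>_::'a. gauss \<sigma>" by unfold_locales
  interpret PJ: finite_product_sigma_finite "\<lambda>_::'a. gauss \<sigma>" J using assms by unfold_locales auto
  interpret pair: pair_sigma_finite "PiM J (\<lambda>_. gauss \<sigma>)" "lborel :: real measure" by unfold_locales
  define f where "f y i x = (if i \<in> I then exp (- (\<beta> / L) * (y - x)\<^sup>2 + s * x\<^sup>2) else (1::real))" for y x :: real and i
  define c where "c = sqrt (\<beta> / pi) * exp (- (L * s * q))"
  have c: "c \<ge> 0" by (simp add: c_def assms less_imp_le)
  have split: "ennreal (exp (- \<beta> * spread I z + s * (\<Sum>i\<in>I. (z i)\<^sup>2 - q)))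
      = ennreal c * (\<integral>\<^sup>+y. ennreal (\<Prod>i\<in>J. f y i (z i)) \<partial>lborel)" for z
  proof -
    have pf: "(\<Prod>i\<in>J. f y i (z i)) = exp (- (\<beta> / L) * (\<Sum>i\<in>I. (y - z i)\<^sup>2)) * exp (s * (\<Sum>i\<in>I. (z i)\<^sup>2))" for y
    proof -
      have "(\<Prod>i\<in>J. f y i (z i)) = (\<Prod>i\<in>I. exp (- (\<beta> / L) * (y - z i)\<^sup>2 + s * (z i)\<^sup>2))"
        unfolding f_def using assms(4,5) by (subst prod.inter_restrict[symmetric]) (auto simp: Int_absorb1)
      also have "\<dots> = exp (\<Sum>i\<in>I. - (\<beta> / L) * (y - z i)\<^sup>2 + s * (z i)\<^sup>2)"
        using finI by (simp add: exp_sum)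
      finally show ?thesis by (simp only: sum.distrib sum_distrib_left[symmetric] exp_add)
    qed
    have "exp (- \<beta> * spread I z + s * (\<Sum>i\<in>I. (z i)\<^sup>2 - q))
        = (exp (- (L * s * q)) * exp (s * (\<Sum>i\<in>I. (z i)\<^sup>2))) * exp (- \<beta> * spread I z)"
      by (simp add: sum_subtractf L_def algebra_simps flip: exp_add)
    then have "ennreal (exp (- \<beta> * spread I z + s * (\<Sum>i\<in>I. (z i)\<^sup>2 - q)))
        = ennreal (exp (- (L * s * q)) * exp (s * (\<Sum>i\<in>I. (z i)\<^sup>2))) * ennreal (exp (- \<beta> * spread I z))"
      by (simp only: ennreal_mult' exp_ge_zero mult_nonneg_nonneg)
    also have "\<dots> = ennreal (exp (- (L * s * q)) * exp (s * (\<Sum>i\<in>I. (z i)\<^sup>2))) * (ennreal (sqrt (\<beta> / pi)) *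
           (\<integral>\<^sup>+y. ennreal (exp (- (\<beta> / L) * (\<Sum>i\<in>I. (y - z i)\<^sup>2))) \<partial>lborel))"
      by (simp only: exp_spread_eq_nn_integral[OF assms(2) finI assms(6)] L_def)
    also have "\<dots> = ennreal c * (ennreal (exp (s * (\<Sum>i\<in>I. (z i)\<^sup>2))) *
           (\<integral>\<^sup>+y. ennreal (exp (- (\<beta> / L) * (\<Sum>i\<in>I. (y - z i)\<^sup>2))) \<partial>lborel))"
      using assms(2) by (simp add: c_def ennreal_mult' ac_simps)
    also have "\<dots> = ennreal c * (\<integral>\<^sup>+y. ennreal (exp (s * (\<Sum>i\<in>I. (z i)\<^sup>2))) *
           ennreal (exp (- (\<beta> / L) * (\<Sum>i\<in>I. (y - z i)\<^sup>2))) \<partial>lborel)"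
      by (subst nn_integral_cmult) simp_all
    also have "\<dots> = ennreal c * (\<integral>\<^sup>+y. ennreal (\<Prod>i\<in>J. f y i (z i)) \<partial>lborel)"
      unfolding pf by (simp add: ennreal_mult' ac_simps)
    finally show ?thesis .
  qed
  have fm: "(\<lambda>(z, y). ennreal (\<Prod>i\<in>J. f y i (z i))) \<in> borel_measurable (PiM J (\<lambda>_. gauss \<sigma>) \<Otimes>\<^sub>M lborel)"
    unfolding f_def by measurable
  have one: "(\<integral>\<^sup>+x. ennreal (f y i x) \<partial>gauss \<sigma>) =
      (if i \<in> I then ennreal (exp (- (\<beta> * u / v) * y\<^sup>2 / L) / sqrt v) else 1)" for y i
  proof (cases "i \<in> I")
    case True
    define b where "b = 2 * \<beta> * y / L"
    have v_eq: "1 - 2 * (s - \<beta> / L) * \<sigma>\<^sup>2 = v" by (simp add: v_def u_def algebra_simps)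
    have "- (\<beta> / L) * (y - x)\<^sup>2 + s * x\<^sup>2 = - (\<beta> / L) * y\<^sup>2 + ((s - \<beta> / L) * x\<^sup>2 + b * x)" for x
      using L by (simp add: b_def field_simps power2_eq_square)
    then have "(\<integral>\<^sup>+x. ennreal (f y i x) \<partial>gauss \<sigma>) =
        (\<integral>\<^sup>+x. ennreal (exp (- (\<beta> / L) * y\<^sup>2)) * ennreal (exp ((s - \<beta> / L) * x\<^sup>2 + b * x)) \<partial>gauss \<sigma>)"
      using True unfolding f_def by (simp only: if_True exp_add) (simp add: ennreal_mult')
    also have "\<dots> = ennreal (exp (- (\<beta> / L) * y\<^sup>2)) * ennreal (exp (b\<^sup>2 * \<sigma>\<^sup>2 / (2 * v)) / sqrt v)"
      using v v_eq by (subst nn_integral_cmult) (simp_all add: nn_integral_gauss_exp_quadratic[OF assms(1)])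
    also have "\<dots> = ennreal (exp (- (\<beta> / L) * y\<^sup>2 + b\<^sup>2 * \<sigma>\<^sup>2 / (2 * v)) / sqrt v)"
      by (simp flip: ennreal_mult' exp_add)
    also have "- (\<beta> / L) * y\<^sup>2 + b\<^sup>2 * \<sigma>\<^sup>2 / (2 * v) = - (\<beta> * u / v) * y\<^sup>2 / L"
    proof -
      have uv: "u = v - 2 * \<beta> * \<sigma>\<^sup>2 / L" by (simp add: v_def)
      show ?thesis unfolding uv b_def using v L by (simp add: field_simps power2_eq_square)
    qed
    finally show ?thesis using True by simp
  next
    case False
    then show ?thesis using N.emeasure_space_1 by (simp add: f_def)
  qed
  have "(\<integral>\<^sup>+z. ennreal (exp (- \<beta> * spread I z + s * (\<Sum>i\<in>I. (z i)\<^sup>2 - q))) \<partial>PiM J (\<lambda>_. gauss \<sigma>))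
      = ennreal c * (\<integral>\<^sup>+z. \<integral>\<^sup>+y. ennreal (\<Prod>i\<in>J. f y i (z i)) \<partial>lborel \<partial>PiM J (\<lambda>_. gauss \<sigma>))"
    unfolding split using fm by (intro nn_integral_cmult) (simp add: lborel.borel_measurable_nn_integral)
  also have "(\<integral>\<^sup>+z. \<integral>\<^sup>+y. ennreal (\<Prod>i\<in>J. f y i (z i)) \<partial>lborel \<partial>PiM J (\<lambda>_. gauss \<sigma>))
      = (\<integral>\<^sup>+y. \<integral>\<^sup>+z. ennreal (\<Prod>i\<in>J. f y i (z i)) \<partial>PiM J (\<lambda>_. gauss \<sigma>) \<partial>lborel)"
    using pair.Fubini'[OF fm] by simp
  also have "\<dots> = (\<integral>\<^sup>+y. ennreal ((1 / sqrt v) ^ L) * ennreal (exp (0 * y - (\<beta> * u / v) * y\<^sup>2)) \<partial>lborel)"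
  proof (intro nn_integral_cong)
    fix y :: real
    have "(\<integral>\<^sup>+z. ennreal (\<Prod>i\<in>J. f y i (z i)) \<partial>PiM J (\<lambda>_. gauss \<sigma>)) = (\<Prod>i\<in>J. \<integral>\<^sup>+x. ennreal (f y i x) \<partial>gauss \<sigma>)"
      by (intro nn_integral_PiM_prod N.prob_space_axioms assms) (auto simp: f_def)
    also have "\<dots> = (\<Prod>i\<in>I. ennreal (exp (- (\<beta> * u / v) * y\<^sup>2 / L) / sqrt v))"
      unfolding one using assms(4,5) by (subst prod.inter_restrict[symmetric]) (auto simp: Int_absorb1)
    also have "\<dots> = ennreal ((exp (- (\<beta> * u / v) * y\<^sup>2 / L) / sqrt v) ^ L)"
      using v by (simp add: L_def ennreal_power)
    also have "(exp (- (\<beta> * u / v) * y\<^sup>2 / L) / sqrt v) ^ L = (1 / sqrt v) ^ L * exp (0 * y - (\<beta> * u / v) * y\<^sup>2)"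
      using L by (simp add: power_divide exp_of_nat_mult[symmetric])
    finally show "(\<integral>\<^sup>+z. ennreal (\<Prod>i\<in>J. f y i (z i)) \<partial>PiM J (\<lambda>_. gauss \<sigma>))
        = ennreal ((1 / sqrt v) ^ L) * ennreal (exp (0 * y - (\<beta> * u / v) * y\<^sup>2))"
      using v by (simp add: ennreal_mult')
  qed
  also have "\<dots> = ennreal ((1 / sqrt v) ^ L) * ennreal (sqrt (pi / (\<beta> * u / v)))"
    using nn_integral_exp_quadratic[of "\<beta> * u / v" 0] u v assms(2) by (subst nn_integral_cmult) simp_all
  also have "ennreal c * \<dots> = ennreal (c * ((1 / sqrt v) ^ L * sqrt (pi / (\<beta> * u / v))))"
    using u v c assms(2) by (simp add: ennreal_mult')
  also have "c * ((1 / sqrt v) ^ L * sqrt (pi / (\<beta> * u / v))) = exp (- (L * s * q)) / (sqrt u * sqrt v ^ (L - 1))"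
  proof -
    obtain K where K: "L = Suc K" using L by (cases L) auto
    show ?thesis using u v assms(2) by (simp add: c_def K real_sqrt_divide real_sqrt_mult power_divide)
  qed
  finally show ?thesis by (simp add: u_def v_def L_def)
qed

lemma nn_integral_single_coordinate:
  fixes \<sigma> \<theta> p :: real
  assumes "\<sigma> > 0" and "2 * \<theta> * \<sigma>\<^sup>2 < 1" and "finite J" and "i \<in> J"
  shows "(\<integral>\<^sup>+z. ennreal (exp (\<theta> * ((z i)\<^sup>2 - p))) \<partial>PiM J (\<lambda>_. gauss \<sigma>))
    = ennreal (exp (- (\<theta> * p)) / sqrt (1 - 2 * \<theta> * \<sigma>\<^sup>2))"
proof -
  interpret N: prob_space "gauss \<sigma>" using assms(1) by (rule prob_space_gauss)
  define f where "f j x = (if j = i then exp (\<theta> * (x\<^sup>2 - p)) else 1)" for j x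
  have "(\<integral>\<^sup>+z. ennreal (exp (\<theta> * ((z i)\<^sup>2 - p))) \<partial>PiM J (\<lambda>_. gauss \<sigma>))
      = (\<integral>\<^sup>+z. ennreal (\<Prod>j\<in>J. f j (z j)) \<partial>PiM J (\<lambda>_. gauss \<sigma>))"
    using assms by (simp add: f_def)
  also have "\<dots> = (\<Prod>j\<in>J. \<integral>\<^sup>+x. ennreal (f j x) \<partial>gauss \<sigma>)"
    by (intro nn_integral_PiM_prod N.prob_space_axioms assms) (auto simp: f_def)
  also have "\<dots> = (\<Prod>j\<in>J. if j = i then \<integral>\<^sup>+x. ennreal (f i x) \<partial>gauss \<sigma> else 1)"
    using N.emeasure_space_1 by (intro prod.cong) (auto simp: f_def)
  also have "\<dots> = (\<integral>\<^sup>+x. ennreal (exp (- (\<theta> * p))) * ennreal (exp (\<theta> * x\<^sup>2 + 0 * x)) \<partial>gauss \<sigma>)"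
    using assms by (simp add: f_def right_diff_distrib exp_diff exp_minus divide_inverse mult.commute flip: ennreal_mult')
  also have "\<dots> = ennreal (exp (- (\<theta> * p)) / sqrt (1 - 2 * \<theta> * \<sigma>\<^sup>2))"
    using nn_integral_gauss_exp_quadratic[OF assms(1,2), of 0]
    by (subst nn_integral_cmult) (simp_all flip: ennreal_mult')
  finally show ?thesis .
qed

section \<open>The list error probability and average radii\<close>

lemma spread_shift:
  assumes "finite I" and "I \<noteq> {}"
  shows "spread I (\<lambda>i. z i - a) = spread I z"
proof -
  define L where "L = real (card I)"
  have L: "L > 0" using assms by (simp add: L_def card_gt_0_iff)
  have 1: "(\<Sum>i\<in>I. (z i - a)\<^sup>2) = (\<Sum>i\<in>I. (z i)\<^sup>2) - 2 * a * (\<Sum>i\<in>I. z i) + L * a\<^sup>2"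
    by (simp add: power2_diff sum.distrib sum_subtractf L_def sum_distrib_left sum_distrib_right mult.commute mult.left_commute)
  have 2: "(\<Sum>i\<in>I. z i - a) = (\<Sum>i\<in>I. z i) - L * a"
    by (simp add: sum_subtractf L_def)
  show ?thesis
    unfolding spread_def 1 2 L_def[symmetric] using L by (simp add: field_simps power2_eq_square)
qed

lemma gaussian_noise_eq: "gaussian_noise n \<sigma> = PiM {..<n} (\<lambda>_. gauss \<sigma>)"
  by (simp add: gaussian_noise_def)

text \<open>A union bound over the lists $J$, together with a Bhattacharyya-type bound for each of them: when all
of $J$ is nearer to the output than $x$, the product over $y \in J$ of the likelihood ratios to the power
$1/L$, $L = |J| + 1$, is at least $1$. The expectation of that product is a Gaussian integral that
factorizes over the coordinates; its value is governed by the average squared radius of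
$J \cup \{x\}$.\<close>
lemma list_error_prob_le_sum_exp_spread:
  fixes C :: "(nat \<Rightarrow> real) set"
  assumes "\<sigma> > 0" and "finite C"
  shows "list_error_prob n \<sigma> l C x \<le>
    (\<Sum>J | J \<subseteq> C - {x} \<and> card J = l.
      exp (- (\<Sum>k<n. spread (insert x J) (\<lambda>y. y k)) / (2 * \<sigma>\<^sup>2)))"
proof -
  define L where "L = real (Suc l)"
  have L: "L > 0" by (simp add: L_def)
  interpret N: prob_space "gauss \<sigma>" using assms(1) by (rule prob_space_gauss)
  interpret G: prob_space "gaussian_noise n \<sigma>"
    unfolding gaussian_noise_eq by (intro prob_space_PiM N.prob_space_axioms)
  define \<J> where "\<J> = {J. J \<subseteq> C - {x} \<and> card J = l}"
  have fin: "finite \<J>" using assms(2) by (auto simp: \<J>_def)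
  have finJ: "finite J" if "J \<in> \<J>" for J using that assms(2) by (auto simp: \<J>_def intro: finite_subset)
  define b where "b J k = (\<Sum>y\<in>J. y k - x k) / (\<sigma>\<^sup>2 * L)" for J :: "(nat \<Rightarrow> real) set" and k
  define c where "c J k = (\<Sum>y\<in>J. (y k - x k)\<^sup>2) / (2 * \<sigma>\<^sup>2 * L)" for J :: "(nat \<Rightarrow> real) set" and k
  (* h J g is the product over y in J of (likelihood of y / likelihood of x)^(1/L) at the output x + g. *)
  define h where "h J g = (\<Prod>k<n. exp (b J k * g k - c J k))" for J and g :: "nat \<Rightarrow> real"
  have int_h: "(\<integral>\<^sup>+g. ennreal (h J g) \<partial>gaussian_noise n \<sigma>)
      = ennreal (exp (- (\<Sum>k<n. spread (insert x J) (\<lambda>y. y k)) / (2 * \<sigma>\<^sup>2)))" if J: "J \<in> \<J>" for J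
  proof -
    have cJ: "real (card (insert x J)) = L" "x \<notin> J"
      using J finJ[OF J] by (auto simp: \<J>_def L_def card_insert_if)
    have e: "- c J k + (b J k)\<^sup>2 * \<sigma>\<^sup>2 / 2 = - spread (insert x J) (\<lambda>y. y k) / (2 * \<sigma>\<^sup>2)" for k
    proof -
      have "spread (insert x J) (\<lambda>y. y k) = spread (insert x J) (\<lambda>y. y k - x k)"
        using finJ[OF J] by (simp add: spread_shift)
      also have "\<dots> = (\<Sum>y\<in>J. (y k - x k)\<^sup>2) / L - ((\<Sum>y\<in>J. y k - x k) / L)\<^sup>2"
        using finJ[OF J] cJ by (simp add: spread_def)
      finally have sp: "spread (insert x J) (\<lambda>y. y k) = \<dots>" .
      have "- (A / (2 * \<sigma>\<^sup>2 * L)) + (D / (\<sigma>\<^sup>2 * L))\<^sup>2 * \<sigma>\<^sup>2 / 2 = - (A / L - (D / L)\<^sup>2) / (2 * \<sigma>\<^sup>2)" for A D :: real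
        using L assms(1) by (simp add: field_simps power2_eq_square)
      then show ?thesis unfolding b_def c_def sp .
    qed
    have "(\<integral>\<^sup>+g. ennreal (h J g) \<partial>gaussian_noise n \<sigma>)
        = (\<Prod>k<n. \<integral>\<^sup>+u. ennreal (exp (b J k * u - c J k)) \<partial>gauss \<sigma>)"
      unfolding h_def gaussian_noise_eq
      by (intro nn_integral_PiM_prod N.prob_space_axioms) auto
    also have "\<dots> = (\<Prod>k<n. ennreal (exp (- spread (insert x J) (\<lambda>y. y k) / (2 * \<sigma>\<^sup>2))))"
    proof (intro prod.cong refl)
      fix k
      have "(\<integral>\<^sup>+u. ennreal (exp (b J k * u - c J k)) \<partial>gauss \<sigma>)
          = (\<integral>\<^sup>+u. ennreal (exp (- c J k)) * ennreal (exp (0 * u\<^sup>2 + b J k * u)) \<partial>gauss \<sigma>)"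
        by (intro nn_integral_cong) (simp flip: ennreal_mult' exp_add)
      also have "\<dots> = ennreal (exp (- c J k)) * ennreal (exp ((b J k)\<^sup>2 * \<sigma>\<^sup>2 / 2))"
        using nn_integral_gauss_exp_quadratic[OF assms(1), of 0 "b J k"]
        by (subst nn_integral_cmult) simp_all
      also have "\<dots> = ennreal (exp (- c J k + (b J k)\<^sup>2 * \<sigma>\<^sup>2 / 2))"
        by (simp only: exp_add ennreal_mult'[symmetric] exp_ge_zero)
      finally show "(\<integral>\<^sup>+u. ennreal (exp (b J k * u - c J k)) \<partial>gauss \<sigma>)
          = ennreal (exp (- spread (insert x J) (\<lambda>y. y k) / (2 * \<sigma>\<^sup>2)))"
        unfolding e .
    qed
    also have "\<dots> = ennreal (exp (\<Sum>k<n. - spread (insert x J) (\<lambda>y. y k) / (2 * \<sigma>\<^sup>2)))"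
      by (simp add: prod_ennreal exp_sum)
    finally show ?thesis by (simp add: sum_divide_distrib sum_negf)
  qed
  define A where "A = {g \<in> space (gaussian_noise n \<sigma>). list_error_event n l C x g}"
  have hm: "h J \<in> borel_measurable (gaussian_noise n \<sigma>)" for J
    unfolding h_def gaussian_noise_eq by measurable
  have cover: "indicator A g \<le> (\<Sum>J\<in>\<J>. ennreal (h J g))" for g
  proof (cases "g \<in> A")
    case True
    then obtain ys where ys: "length ys = l" "distinct ys" "set ys \<subseteq> C - {x}"
      and closer: "\<forall>y\<in>set ys. L2_set (\<lambda>k. y k - (x k + g k)) {..<n} < L2_set g {..<n}"
      by (auto simp: A_def list_error_event_def)
    have J: "set ys \<in> \<J>" using ys by (simp add: \<J>_def distinct_card)
    have pos: "0 \<le> (\<Sum>k<n. 2 * g k * (y k - x k) - (y k - x k)\<^sup>2)" if "y \<in> set ys" for y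
    proof -
      have "(\<Sum>k<n. (y k - (x k + g k))\<^sup>2) < (\<Sum>k<n. (g k)\<^sup>2)"
        using closer that by (auto simp: L2_set_def)
      also have "(\<Sum>k<n. (y k - (x k + g k))\<^sup>2)
          = (\<Sum>k<n. (g k)\<^sup>2) - (\<Sum>k<n. 2 * g k * (y k - x k) - (y k - x k)\<^sup>2)"
        unfolding sum_subtractf[symmetric] by (intro sum.cong) (auto simp: power2_eq_square algebra_simps)
      finally show ?thesis by simp
    qed
    have "h (set ys) g = exp (\<Sum>k<n. b (set ys) k * g k - c (set ys) k)"
      by (simp add: h_def exp_sum)
    also have "(\<Sum>k<n. b (set ys) k * g k - c (set ys) k)
        = (\<Sum>k<n. \<Sum>y\<in>set ys. 2 * g k * (y k - x k) - (y k - x k)\<^sup>2) / (2 * \<sigma>\<^sup>2 * L)"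
    proof (subst sum_divide_distrib, intro sum.cong refl)
      fix k
      have "(\<Sum>y\<in>set ys. 2 * g k * (y k - x k) - (y k - x k)\<^sup>2)
          = 2 * g k * (\<Sum>y\<in>set ys. y k - x k) - (\<Sum>y\<in>set ys. (y k - x k)\<^sup>2)"
        by (subst sum_subtractf) (simp only: sum_distrib_left)
      moreover have "D / (\<sigma>\<^sup>2 * L) * u - A / (2 * \<sigma>\<^sup>2 * L) = (2 * u * D - A) / (2 * \<sigma>\<^sup>2 * L)" for D A u :: real
        using L assms(1) by (simp add: field_simps)
      ultimately show "b (set ys) k * g k - c (set ys) k
          = (\<Sum>y\<in>set ys. 2 * g k * (y k - x k) - (y k - x k)\<^sup>2) / (2 * \<sigma>\<^sup>2 * L)"
        unfolding b_def c_def by simp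
    qed
    also have "(\<Sum>k<n. \<Sum>y\<in>set ys. 2 * g k * (y k - x k) - (y k - x k)\<^sup>2)
        = (\<Sum>y\<in>set ys. \<Sum>k<n. 2 * g k * (y k - x k) - (y k - x k)\<^sup>2)"
      by (rule sum.swap)
    finally have "1 \<le> h (set ys) g"
      using L assms(1) pos by (simp add: sum_nonneg)
    then have "1 \<le> ennreal (h (set ys) g)" by simp
    also have "\<dots> \<le> (\<Sum>J\<in>\<J>. ennreal (h J g))"
      using fin J by (intro member_le_sum) auto
    finally show ?thesis using True by simp
  qed simp
  have "emeasure (gaussian_noise n \<sigma>) A \<le> (\<Sum>J\<in>\<J>. ennreal (exp (- (\<Sum>k<n. spread (insert x J) (\<lambda>y. y k)) / (2 * \<sigma>\<^sup>2))))"
    (* A set outside the sigma-algebra has measure 0 by definition. *)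
  proof (cases "A \<in> sets (gaussian_noise n \<sigma>)")
    case True
    then have "emeasure (gaussian_noise n \<sigma>) A = (\<integral>\<^sup>+g. indicator A g \<partial>gaussian_noise n \<sigma>)"
      by simp
    also have "\<dots> \<le> (\<integral>\<^sup>+g. (\<Sum>J\<in>\<J>. ennreal (h J g)) \<partial>gaussian_noise n \<sigma>)"
      by (intro nn_integral_mono cover)
    also have "\<dots> = (\<Sum>J\<in>\<J>. \<integral>\<^sup>+g. ennreal (h J g) \<partial>gaussian_noise n \<sigma>)"
      using hm by (intro nn_integral_sum) simp
    finally show ?thesis by (simp add: int_h)
  qed (simp add: emeasure_notin_sets)
  then have "ennreal (G.prob A) \<le> ennreal (\<Sum>J\<in>\<J>. exp (- (\<Sum>k<n. spread (insert x J) (\<lambda>y. y k)) / (2 * \<sigma>\<^sup>2)))"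
    by (simp add: G.emeasure_eq_measure sum_ennreal)
  then show ?thesis
    unfolding list_error_prob_def A_def[symmetric] \<J>_def[symmetric]
    by (subst (asm) ennreal_le_iff) (auto intro: sum_nonneg)
qed

text \<open>The $\ell^1$ norm is at least the $\ell^\rho$ norm. This is the loss accepted in expurgation: the sum
whose expectation is computed contains the weights to the power $1/\rho$ only.\<close>
lemma sum_exp_le_powr_sum_exp:
  fixes w :: "'a \<Rightarrow> real"
  assumes "finite A" and "\<rho> \<ge> 1"
  shows "(\<Sum>a\<in>A. exp (- (\<rho> * w a))) \<le> (\<Sum>a\<in>A. exp (- w a)) powr \<rho>"
proof (cases "A = {}")
  case False
  define S where "S = (\<Sum>a\<in>A. exp (- w a))"
  have S: "S > 0" using assms False by (simp add: S_def sum_pos)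
  have "(\<Sum>a\<in>A. exp (- (\<rho> * w a))) \<le> (\<Sum>a\<in>A. exp (- w a) * S powr (\<rho> - 1))"
  proof (intro sum_mono)
    fix a assume a: "a \<in> A"
    have "exp (- w a) \<le> S" unfolding S_def using assms a by (intro member_le_sum) auto
    then have "exp (- w a) powr (\<rho> - 1) \<le> S powr (\<rho> - 1)" using assms by (intro powr_mono2) auto
    moreover have "exp (- (\<rho> * w a)) = exp (- w a) * exp (- w a) powr (\<rho> - 1)"
      by (simp add: powr_def algebra_simps flip: exp_add)
    ultimately show "exp (- (\<rho> * w a)) \<le> exp (- w a) * S powr (\<rho> - 1)" by simp
  qed
  also have "\<dots> = S * S powr (\<rho> - 1)" by (simp add: S_def sum_distrib_right)
  also have "\<dots> = S powr \<rho>" using S by (simp add: powr_mult_base)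
  finally show ?thesis by (simp add: S_def)
qed simp

section \<open>Random codebooks\<close>

lemma nn_integral_array_sum:
  fixes W :: "'b measure" and \<psi> :: "'j \<Rightarrow> 'b \<Rightarrow> real"
  assumes "prob_space W" and "finite T"
    and "\<And>j. j \<in> T \<Longrightarrow> \<psi> j \<in> borel_measurable W"
    and "\<And>j z. j \<in> T \<Longrightarrow> \<psi> j z \<ge> 0"
    and "\<And>j. j \<in> T \<Longrightarrow> (\<integral>\<^sup>+z. ennreal (\<psi> j z) \<partial>W) = ennreal (g j)"
    and "\<And>j. j \<in> T \<Longrightarrow> g j \<ge> 0"
  shows "(\<integral>\<^sup>+X. ennreal (\<Sum>j\<in>T. \<Prod>k<n. \<psi> j (X k)) \<partial>PiM {..<n::nat} (\<lambda>_. W)) = ennreal (\<Sum>j\<in>T. g j ^ n)"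
proof -
  have [measurable]: "(\<lambda>X. \<Prod>k<n. \<psi> j (X k)) \<in> borel_measurable (PiM {..<n} (\<lambda>_. W))" if "j \<in> T" for j
  proof -
    note assms(3)[OF that, measurable]
    show ?thesis by measurable
  qed
  have "(\<integral>\<^sup>+X. ennreal (\<Sum>j\<in>T. \<Prod>k<n. \<psi> j (X k)) \<partial>PiM {..<n} (\<lambda>_. W))
      = (\<integral>\<^sup>+X. (\<Sum>j\<in>T. ennreal (\<Prod>k<n. \<psi> j (X k))) \<partial>PiM {..<n} (\<lambda>_. W))"
    using assms(4) by (intro nn_integral_cong) (simp add: sum_ennreal prod_nonneg)
  also have "\<dots> = (\<Sum>j\<in>T. \<integral>\<^sup>+X. ennreal (\<Prod>k<n. \<psi> j (X k)) \<partial>PiM {..<n} (\<lambda>_. W))"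
    by (intro nn_integral_sum) simp
  also have "\<dots> = (\<Sum>j\<in>T. \<Prod>k<n. \<integral>\<^sup>+z. ennreal (\<psi> j z) \<partial>W)"
    using assms by (intro sum.cong refl nn_integral_PiM_prod) auto
  also have "\<dots> = (\<Sum>j\<in>T. ennreal (g j ^ n))"
    using assms by (intro sum.cong refl) (simp add: ennreal_power)
  finally show ?thesis using assms(6) by (simp add: sum_ennreal)
qed

text \<open>The probabilistic method. The arrays $X$ have independent Gaussian entries, $X\,k\,i$ being coordinate $k$ of
codeword $i$; each of the three functionals is a sum of products over the coordinates, so its
expectation is a sum of $n$-th powers of the one-coordinate integrals. The first functional measures
clustering, the second bounds the number of codewords outside the shell $n q \le \|x\|^2 \le n p$
when $\theta \ge 0 \ge \eta$ (Chernoff), and the third bounds the number of pairs of equal codewords.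
Exponentials stand for indicators throughout, which keeps every integral explicit.\<close>
lemma random_codebook:
  fixes \<tau> \<beta> s q p \<theta> \<eta> \<mu> a b \<gamma> hi lo dup :: real and L M n :: nat
  defines "\<gamma> \<equiv> exp (- (L * s * q)) / (sqrt (1 - 2 * s * \<tau>\<^sup>2) * sqrt (1 - 2 * s * \<tau>\<^sup>2 + 2 * \<beta> * \<tau>\<^sup>2 / L) ^ (L - 1))"
    and "hi \<equiv> exp (- (\<theta> * p)) / sqrt (1 - 2 * \<theta> * \<tau>\<^sup>2)"
    and "lo \<equiv> exp (- (\<eta> * q)) / sqrt (1 - 2 * \<eta> * \<tau>\<^sup>2)"
    and "dup \<equiv> 1 / sqrt (1 + \<mu> * \<tau>\<^sup>2)"
  assumes pos: "\<tau> > 0" "\<beta> > 0" "\<mu> > 0" "L > 0" "a > 0" "b > 0"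
    and small: "2 * s * \<tau>\<^sup>2 < 1" "2 * \<theta> * \<tau>\<^sup>2 < 1" "2 * \<eta> * \<tau>\<^sup>2 < 1"
    and total: "(M choose L) * \<gamma> ^ n / a + M * (hi ^ n + lo ^ n) / b + (M choose 2) * dup ^ n < 1"
  obtains X :: "nat \<Rightarrow> nat \<Rightarrow> real" where
    "(\<Sum>I | I \<subseteq> {..<M} \<and> card I = L. \<Prod>k<n. exp (- \<beta> * spread I (X k) + s * (\<Sum>i\<in>I. (X k i)\<^sup>2 - q))) < a"
    "(\<Sum>i<M. \<Prod>k<n. exp (\<theta> * ((X k i)\<^sup>2 - p))) + (\<Sum>i<M. \<Prod>k<n. exp (\<eta> * ((X k i)\<^sup>2 - q))) < b"
    "(\<Sum>I | I \<subseteq> {..<M} \<and> card I = 2. \<Prod>k<n. exp (- \<mu> * spread I (X k))) < 1"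
proof -
  define W where "W = PiM {..<M} (\<lambda>_::nat. gauss \<tau>)"
  define \<Omega> where "\<Omega> = PiM {..<n} (\<lambda>_::nat. W)"
  interpret N: prob_space "gauss \<tau>" using pos(1) by (rule prob_space_gauss)
  interpret W: prob_space W unfolding W_def by (intro prob_space_PiM N.prob_space_axioms)
  interpret \<Omega>: prob_space \<Omega> unfolding \<Omega>_def by (intro prob_space_PiM W.prob_space_axioms)
  define F1 where "F1 X = (\<Sum>I | I \<subseteq> {..<M} \<and> card I = L. \<Prod>k<n. exp (- \<beta> * spread I (X k) + s * (\<Sum>i\<in>I. (X k i)\<^sup>2 - q)))" for X
  define F2 where "F2 X = (\<Sum>i<M. \<Prod>k<n. exp (\<theta> * ((X k i)\<^sup>2 - p)))" for X :: "nat \<Rightarrow> nat \<Rightarrow> real"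
  define F3 where "F3 X = (\<Sum>i<M. \<Prod>k<n. exp (\<eta> * ((X k i)\<^sup>2 - q)))" for X :: "nat \<Rightarrow> nat \<Rightarrow> real"
  define F4 where "F4 X = (\<Sum>I | I \<subseteq> {..<M} \<and> card I = 2. \<Prod>k<n. exp (- \<mu> * spread I (X k)))" for X
  have nonneg: "F1 X \<ge> 0" "F2 X \<ge> 0" "F3 X \<ge> 0" "F4 X \<ge> 0" for X
    by (auto simp: F1_def F2_def F3_def F4_def intro!: sum_nonneg prod_nonneg)
  have fin: "finite {I. I \<subseteq> {..<M} \<and> card I = l}" for l
    by (rule finite_subset[of _ "Pow {..<M}"]) auto
  have wm: "(\<lambda>z. exp (- c * spread I z + d * (\<Sum>i\<in>I. (z i)\<^sup>2 - r))) \<in> borel_measurable W"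
    if "I \<subseteq> {..<M}" for c d r :: real and I
  proof -
    have [measurable]: "(\<lambda>z. z i) \<in> borel_measurable W" if "i \<in> I" for i
      using measurable_component_singleton[of i "{..<M}" "\<lambda>_. gauss \<tau>"] that \<open>I \<subseteq> {..<M}\<close>
      by (auto simp: W_def)
    show ?thesis unfolding spread_def by measurable
  qed
  have wm0: "(\<lambda>z. exp (- c * spread I z)) \<in> borel_measurable W" if "I \<subseteq> {..<M}" for c :: real and I
    using wm[OF that, of c 0 0] by simp
  have cm: "(\<lambda>z. exp (c * ((z i)\<^sup>2 - r))) \<in> borel_measurable W" if "i < M" for c r :: real and i
  proof -
    have [measurable]: "(\<lambda>z. z i) \<in> borel_measurable W"
      using measurable_component_singleton[of i "{..<M}" "\<lambda>_. gauss \<tau>"] that by (simp add: W_def)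
    show ?thesis by measurable
  qed
  have int1: "(\<integral>\<^sup>+X. ennreal (F1 X) \<partial>\<Omega>) = ennreal ((M choose L) * \<gamma> ^ n)"
  proof -
    have "(\<integral>\<^sup>+X. ennreal (F1 X) \<partial>\<Omega>) = ennreal (\<Sum>I | I \<subseteq> {..<M} \<and> card I = L. \<gamma> ^ n)"
      unfolding F1_def \<Omega>_def
    proof (rule nn_integral_array_sum[OF W.prob_space_axioms fin])
      fix I assume "I \<in> {I. I \<subseteq> {..<M} \<and> card I = L}"
      then have I: "I \<subseteq> {..<M}" "card I = L" "I \<noteq> {}" using pos by auto
      show "(\<integral>\<^sup>+z. ennreal (exp (- \<beta> * spread I z + s * (\<Sum>i\<in>I. (z i)\<^sup>2 - q))) \<partial>W) = ennreal \<gamma>"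
        unfolding W_def nn_integral_column_weight[OF pos(1,2) small(1) finite_lessThan I(1,3)] I(2) \<gamma>_def ..
    qed (use wm small pos in \<open>auto simp: \<gamma>_def intro!: divide_nonneg_nonneg\<close>)
    then show ?thesis by (simp add: n_subsets)
  qed
  have int2: "(\<integral>\<^sup>+X. ennreal (F2 X) \<partial>\<Omega>) = ennreal (M * hi ^ n)"
  proof -
    have "(\<integral>\<^sup>+X. ennreal (F2 X) \<partial>\<Omega>) = ennreal (\<Sum>i<M. hi ^ n)"
      unfolding F2_def \<Omega>_def
    proof (rule nn_integral_array_sum[OF W.prob_space_axioms finite_lessThan])
      fix i assume "i \<in> {..<M}"
      then show "(\<integral>\<^sup>+z. ennreal (exp (\<theta> * ((z i)\<^sup>2 - p))) \<partial>W) = ennreal hi"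
        unfolding W_def hi_def by (intro nn_integral_single_coordinate pos small) auto
    qed (use cm small in \<open>auto simp: hi_def\<close>)
    then show ?thesis by simp
  qed
  have int3: "(\<integral>\<^sup>+X. ennreal (F3 X) \<partial>\<Omega>) = ennreal (M * lo ^ n)"
  proof -
    have "(\<integral>\<^sup>+X. ennreal (F3 X) \<partial>\<Omega>) = ennreal (\<Sum>i<M. lo ^ n)"
      unfolding F3_def \<Omega>_def
    proof (rule nn_integral_array_sum[OF W.prob_space_axioms finite_lessThan])
      fix i assume "i \<in> {..<M}"
      then show "(\<integral>\<^sup>+z. ennreal (exp (\<eta> * ((z i)\<^sup>2 - q))) \<partial>W) = ennreal lo"
        unfolding W_def lo_def by (intro nn_integral_single_coordinate pos small) auto
    qed (use cm small in \<open>auto simp: lo_def\<close>)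
    then show ?thesis by simp
  qed
  have int4: "(\<integral>\<^sup>+X. ennreal (F4 X) \<partial>\<Omega>) = ennreal ((M choose 2) * dup ^ n)"
  proof -
    have "(\<integral>\<^sup>+X. ennreal (F4 X) \<partial>\<Omega>) = ennreal (\<Sum>I | I \<subseteq> {..<M} \<and> card I = 2. dup ^ n)"
      unfolding F4_def \<Omega>_def
    proof (rule nn_integral_array_sum[OF W.prob_space_axioms fin])
      fix I assume "I \<in> {I. I \<subseteq> {..<M} \<and> card I = 2}"
      then have I: "I \<subseteq> {..<M}" "card I = 2" "I \<noteq> {}" by auto
      have zero: "2 * 0 * \<tau>\<^sup>2 < 1" by simp
      show "(\<integral>\<^sup>+z. ennreal (exp (- \<mu> * spread I z)) \<partial>W) = ennreal dup"
        using nn_integral_column_weight[OF pos(1,3) zero finite_lessThan I(1,3), of 0] I(2)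
        by (simp add: W_def dup_def)
    qed (use wm0 pos in \<open>auto simp: dup_def\<close>)
    then show ?thesis by (simp add: n_subsets)
  qed
  have pm: "(\<lambda>X. g (X k)) \<in> borel_measurable \<Omega>" if "g \<in> borel_measurable W" "k \<in> {..<n}" for g :: "(nat \<Rightarrow> real) \<Rightarrow> real" and k
    using measurable_compose[OF measurable_component_singleton[OF that(2)] that(1)] by (simp add: \<Omega>_def)
  have [measurable]: "F1 \<in> borel_measurable \<Omega>"
    unfolding F1_def by (intro borel_measurable_sum borel_measurable_prod pm[OF wm]; simp)
  have [measurable]: "F4 \<in> borel_measurable \<Omega>"
    unfolding F4_def by (intro borel_measurable_sum borel_measurable_prod pm[OF wm0]; simp)
  have [measurable]: "F2 \<in> borel_measurable \<Omega>" "F3 \<in> borel_measurable \<Omega>"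
    unfolding F2_def F3_def by (intro borel_measurable_sum borel_measurable_prod pm[OF cm]; simp)+
  have g0: "\<gamma> \<ge> 0" "hi \<ge> 0" "lo \<ge> 0" "dup \<ge> 0"
    using small pos by (auto simp: \<gamma>_def hi_def lo_def dup_def intro!: divide_nonneg_nonneg)
  define F where "F X = F1 X / a + (F2 X + F3 X) / b + F4 X" for X
  have "(\<integral>\<^sup>+X. ennreal (F X) \<partial>\<Omega>)
      = (\<integral>\<^sup>+X. ennreal (1 / a) * ennreal (F1 X) + ennreal (1 / b) * ennreal (F2 X) + ennreal (1 / b) * ennreal (F3 X) + ennreal (F4 X) \<partial>\<Omega>)"
    using nonneg pos
    by (intro nn_integral_cong) (simp add: F_def add_divide_distrib flip: ennreal_mult' ennreal_plus)
  also have "\<dots> = ennreal (1 / a) * ennreal ((M choose L) * \<gamma> ^ n) + ennreal (1 / b) * ennreal (M * hi ^ n)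
      + ennreal (1 / b) * ennreal (M * lo ^ n) + ennreal ((M choose 2) * dup ^ n)"
    by (simp add: nn_integral_add nn_integral_cmult int1 int2 int3 int4)
  also have "\<dots> = ennreal ((M choose L) * \<gamma> ^ n / a + M * (hi ^ n + lo ^ n) / b + (M choose 2) * dup ^ n)"
    using g0 pos by (simp add: add_divide_distrib distrib_left add.assoc flip: ennreal_mult' ennreal_plus)
  also have "\<dots> < 1" using total by (simp add: ennreal_less_one_iff)
  finally have lt: "(\<integral>\<^sup>+X. ennreal (F X) \<partial>\<Omega>) < 1" .
  have "\<exists>X\<in>space \<Omega>. F X < 1"
  proof (rule ccontr)
    assume "\<not> (\<exists>X\<in>space \<Omega>. F X < 1)"
    then have "(\<integral>\<^sup>+X. 1 \<partial>\<Omega>) \<le> (\<integral>\<^sup>+X. ennreal (F X) \<partial>\<Omega>)"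
      by (intro nn_integral_mono) (auto simp: not_less)
    then show False using lt \<Omega>.emeasure_space_1 by simp
  qed
  then obtain X where X: "F X < 1" by blast
  have "F1 X / a < 1" "(F2 X + F3 X) / b < 1" "F4 X < 1"
  proof -
    have "F1 X / a \<ge> 0" "(F2 X + F3 X) / b \<ge> 0" using nonneg pos by simp_all
    then show "F1 X / a < 1" "(F2 X + F3 X) / b < 1" "F4 X < 1"
      using X nonneg(4)[of X] unfolding F_def by linarith+
  qed
  then show thesis using that[of X] pos unfolding F1_def F2_def F3_def F4_def by simp
qed

section \<open>Expurgation\<close>

text \<open>The deterministic half of the random coding argument. At most $M/4$ codewords lie outside the shell.
Each $L$-subset of the others contributes its weight to $L$ codewords, so by averaging at most $M/4$ of them carry
more than $4 L a / M$; the remaining codewords, at least half, form the code. Equal codewords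
are impossible, because a pair of them would alone contribute $1$ to the sum in the last hypothesis.\<close>
lemma expurgated_code:
  fixes X :: "nat \<Rightarrow> nat \<Rightarrow> real" and \<beta> s q p \<theta> \<eta> \<mu> a :: real and L M n :: nat
  assumes L: "L > 0" and n: "n > 0" and M: "M > 0" and s: "s \<ge> 0" and \<theta>: "\<theta> \<ge> 0" and \<eta>: "\<eta> \<le> 0"
    and close: "(\<Sum>I | I \<subseteq> {..<M} \<and> card I = L. \<Prod>k<n. exp (- \<beta> * spread I (X k) + s * (\<Sum>i\<in>I. (X k i)\<^sup>2 - q))) < a"
    and norms: "(\<Sum>i<M. \<Prod>k<n. exp (\<theta> * ((X k i)\<^sup>2 - p))) + (\<Sum>i<M. \<Prod>k<n. exp (\<eta> * ((X k i)\<^sup>2 - q))) < M / 4"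
    and dups: "(\<Sum>I | I \<subseteq> {..<M} \<and> card I = 2. \<Prod>k<n. exp (- \<mu> * spread I (X k))) < 1"
  obtains C where "finite C" "C \<subseteq> real_space n" "\<And>x. x \<in> C \<Longrightarrow> (\<Sum>k<n. (x k)\<^sup>2) \<le> n * p"
    "card C \<le> M" "M \<le> 2 * card C"
    "\<And>x. x \<in> C \<Longrightarrow> (\<Sum>J | J \<subseteq> C - {x} \<and> card J = L - 1.
        exp (- (\<beta> * (\<Sum>k<n. spread (insert x J) (\<lambda>y. y k))))) \<le> 4 * L * a / M"
proof -
  define cw where "cw i = restrict (\<lambda>k. X k i) {..<n}" for i
  have cw_k: "cw i k = X k i" if "k < n" for i k using that by (simp add: cw_def)
  have fin: "finite {I. I \<subseteq> A \<and> Q I}" if "finite A" for A :: "nat set" and Q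
    by (rule finite_subset[of _ "Pow A"]) (use that in auto)
  have inj: "inj_on cw {..<M}"
  proof (rule inj_onI, rule ccontr)
    fix i j assume ij: "i \<in> {..<M}" "j \<in> {..<M}" "cw i = cw j" "i \<noteq> j"
    have eq: "X k i = X k j" if "k < n" for k using ij(3) cw_k[OF that] by metis
    have "(\<Prod>k<n. exp (- \<mu> * spread {i, j} (X k))) = 1"
      using ij(4) eq by (intro prod.neutral) (auto simp: spread_def)
    moreover have "(\<Prod>k<n. exp (- \<mu> * spread {i, j} (X k)))
        \<le> (\<Sum>I | I \<subseteq> {..<M} \<and> card I = 2. \<Prod>k<n. exp (- \<mu> * spread I (X k)))"
      using ij fin[of "{..<M}"]
      by (intro member_le_sum[of "{i, j}" _ "\<lambda>I. \<Prod>k<n. exp (- \<mu> * spread I (X k))"])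
        (auto intro!: prod_nonneg)
    ultimately show False using dups by linarith
  qed
  define e where "e I = exp (- (\<beta> * (\<Sum>k<n. spread I (X k))))" for I
  define A where "A = {i\<in>{..<M}. n * q \<le> (\<Sum>k<n. (X k i)\<^sup>2) \<and> (\<Sum>k<n. (X k i)\<^sup>2) \<le> n * p}"
  have finA: "finite A" "A \<subseteq> {..<M}" by (auto simp: A_def)
  have card_bad: "real (card ({..<M} - A)) \<le> M / 4"
  proof -
    let ?g = "\<lambda>i. (\<Prod>k<n. exp (\<theta> * ((X k i)\<^sup>2 - p))) + (\<Prod>k<n. exp (\<eta> * ((X k i)\<^sup>2 - q)))"
    have g: "1 \<le> ?g i" if i: "i \<in> {..<M} - A" for i
    proof -
      have hi: "(\<Prod>k<n. exp (\<theta> * ((X k i)\<^sup>2 - p))) = exp (\<theta> * ((\<Sum>k<n. (X k i)\<^sup>2) - n * p))"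
        by (simp add: sum_subtractf flip: exp_sum sum_distrib_left)
      have lo: "(\<Prod>k<n. exp (\<eta> * ((X k i)\<^sup>2 - q))) = exp (\<eta> * ((\<Sum>k<n. (X k i)\<^sup>2) - n * q))"
        by (simp add: sum_subtractf flip: exp_sum sum_distrib_left)
      consider "(\<Sum>k<n. (X k i)\<^sup>2) < n * q" | "(\<Sum>k<n. (X k i)\<^sup>2) > n * p" using i by (auto simp: A_def)
      then show ?thesis
      proof cases
        case 1
        then have "1 \<le> exp (\<eta> * ((\<Sum>k<n. (X k i)\<^sup>2) - n * q))" using \<eta> by (simp add: mult_nonpos_nonpos)
        then show ?thesis unfolding hi lo by (simp add: add_increasing)
      next
        case 2
        then have "1 \<le> exp (\<theta> * ((\<Sum>k<n. (X k i)\<^sup>2) - n * p))" using \<theta> by simp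
        then show ?thesis unfolding hi lo by (simp add: add_increasing2)
      qed
    qed
    have "real (card ({..<M} - A)) \<le> (\<Sum>i\<in>{..<M} - A. ?g i)"
      using sum_mono[of "{..<M} - A" "\<lambda>_. 1::real" ?g] g by simp
    also have "\<dots> \<le> (\<Sum>i<M. ?g i)"
      by (intro sum_mono2) (auto intro!: add_nonneg_nonneg prod_nonneg)
    finally show ?thesis using norms by (simp add: sum.distrib)
  qed
  have sum_e: "(\<Sum>I | I \<subseteq> A \<and> card I = L. e I) \<le> a"
  proof -
    have "(\<Sum>I | I \<subseteq> A \<and> card I = L. e I)
        \<le> (\<Sum>I | I \<subseteq> A \<and> card I = L. \<Prod>k<n. exp (- \<beta> * spread I (X k) + s * (\<Sum>i\<in>I. (X k i)\<^sup>2 - q)))"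
    proof (intro sum_mono)
      fix I assume I: "I \<in> {I. I \<subseteq> A \<and> card I = L}"
      have "0 \<le> (\<Sum>i\<in>I. \<Sum>k<n. (X k i)\<^sup>2 - q)"
      proof (rule sum_nonneg)
        fix i assume "i \<in> I"
        then have "n * q \<le> (\<Sum>k<n. (X k i)\<^sup>2)" using I by (auto simp: A_def)
        then show "0 \<le> (\<Sum>k<n. (X k i)\<^sup>2 - q)" by (simp add: sum_subtractf)
      qed
      then have "0 \<le> s * (\<Sum>k<n. \<Sum>i\<in>I. (X k i)\<^sup>2 - q)"
        using s by (subst sum.swap) simp
      then have "e I \<le> exp (- (\<beta> * (\<Sum>k<n. spread I (X k))) + s * (\<Sum>k<n. \<Sum>i\<in>I. (X k i)\<^sup>2 - q))"
        by (simp add: e_def)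
      also have "\<dots> = (\<Prod>k<n. exp (- \<beta> * spread I (X k) + s * (\<Sum>i\<in>I. (X k i)\<^sup>2 - q)))"
        by (simp only: exp_sum[symmetric] finite_lessThan sum.distrib sum_distrib_left mult_minus_left sum_negf)
      finally show "e I \<le> (\<Prod>k<n. exp (- \<beta> * spread I (X k) + s * (\<Sum>i\<in>I. (X k i)\<^sup>2 - q)))" .
    qed
    also have "\<dots> \<le> (\<Sum>I | I \<subseteq> {..<M} \<and> card I = L. \<Prod>k<n. exp (- \<beta> * spread I (X k) + s * (\<Sum>i\<in>I. (X k i)\<^sup>2 - q)))"
      using finA fin[of "{..<M}"] by (intro sum_mono2) (auto intro!: prod_nonneg)
    finally show ?thesis using close by simp
  qed
  have a: "a > 0"
    using close by (rule le_less_trans[rotated]) (auto intro!: sum_nonneg prod_nonneg)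
  define w where "w i = (\<Sum>I | I \<subseteq> A \<and> card I = L \<and> i \<in> I. e I)" for i
  have sum_w: "(\<Sum>i\<in>A. w i) \<le> L * a"
  proof -
    have "(\<Sum>i\<in>A. w i) = (\<Sum>i\<in>A. \<Sum>I | I \<subseteq> A \<and> card I = L. if i \<in> I then e I else 0)"
      unfolding w_def using finA fin by (intro sum.cong refl sum.mono_neutral_cong_left) auto
    also have "\<dots> = (\<Sum>I | I \<subseteq> A \<and> card I = L. \<Sum>i\<in>A. if i \<in> I then e I else 0)"
      by (rule sum.swap)
    also have "\<dots> = (\<Sum>I | I \<subseteq> A \<and> card I = L. L * e I)"
      using finA(1) by (intro sum.cong refl) (auto simp: sum.inter_restrict[symmetric] Int_absorb1)
    also have "\<dots> = L * (\<Sum>I | I \<subseteq> A \<and> card I = L. e I)" by (simp add: sum_distrib_left)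
    finally show ?thesis using sum_e by (simp add: mult_left_mono)
  qed
  define B where "B = {i\<in>A. w i > 4 * L * a / M}"
  have w0: "w i \<ge> 0" for i by (auto simp: w_def e_def intro!: sum_nonneg)
  have card_B: "real (card B) \<le> M / 4"
  proof -
    have "card B * (4 * L * a / M) \<le> (\<Sum>i\<in>B. w i)"
      using sum_mono[of B "\<lambda>_. 4 * L * a / M" w] by (simp add: B_def)
    also have "\<dots> \<le> (\<Sum>i\<in>A. w i)" using finA w0 by (intro sum_mono2) (auto simp: B_def)
    also note sum_w
    finally have "(L * a) * (card B * 4 / M) \<le> (L * a) * 1" by (simp add: algebra_simps)
    then have "card B * 4 / M \<le> 1" using L a by (subst (asm) mult_le_cancel_left_pos) auto
    then show ?thesis using M by (simp add: field_simps)
  qed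
  define C where "C = cw ` (A - B)"
  have finC: "finite C" using finA by (simp add: C_def)
  have sub: "A - B \<subseteq> {..<M}" using finA by auto
  have cardC: "card C = card (A - B)"
    unfolding C_def by (rule card_image) (rule inj_on_subset[OF inj sub])
  have "M = card ({..<M} - A) + card B + card (A - B)"
  proof -
    have "M = card (({..<M} - A) \<union> (B \<union> (A - B)))"
      using finA by (metis (no_types, lifting) B_def Diff_partition Un_commute card_lessThan mem_Collect_eq subsetI)
    also have "\<dots> = card ({..<M} - A) + (card B + card (A - B))"
      using finA by (subst card_Un_disjoint, (auto simp: B_def)[3], subst card_Un_disjoint) (auto simp: B_def)
    finally show ?thesis by simp
  qed
  then have M_le: "real M \<le> 2 * real (card (A - B))" using card_bad card_B by linarith
  have spread_cw: "spread (cw ` I) (\<lambda>y. y k) = spread I (X k)" if "I \<subseteq> {..<M}" "k < n" for I k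
  proof -
    have "inj_on cw I" using inj that(1) by (rule inj_on_subset)
    then show ?thesis using that(2) by (simp add: spread_def card_image sum.reindex cw_k)
  qed
  have sum_C: "(\<Sum>J | J \<subseteq> C - {x} \<and> card J = L - 1. exp (- (\<beta> * (\<Sum>k<n. spread (insert x J) (\<lambda>y. y k))))) \<le> 4 * L * a / M"
    if x: "x \<in> C" for x
  proof -
    obtain i where i: "i \<in> A" "i \<notin> B" "x = cw i" using x unfolding C_def by blast
    have "(\<Sum>J | J \<subseteq> C - {x} \<and> card J = L - 1. exp (- (\<beta> * (\<Sum>k<n. spread (insert x J) (\<lambda>y. y k))))) \<le> w i"
      unfolding w_def
    proof (rule sum_le_included[where i = "\<lambda>I. cw ` I - {x}"])
      show "finite {J. J \<subseteq> C - {x} \<and> card J = L - 1}"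
        by (rule finite_subset[of _ "Pow C"]) (use finC in auto)
      show "finite {I. I \<subseteq> A \<and> card I = L \<and> i \<in> I}" by (rule fin[OF finA(1)])
      show "\<forall>I\<in>{I. I \<subseteq> A \<and> card I = L \<and> i \<in> I}. 0 \<le> e I" by (simp add: e_def)
      show "\<forall>J\<in>{J. J \<subseteq> C - {x} \<and> card J = L - 1}. \<exists>I\<in>{I. I \<subseteq> A \<and> card I = L \<and> i \<in> I}.
          cw ` I - {x} = J \<and> exp (- (\<beta> * (\<Sum>k<n. spread (insert x J) (\<lambda>y. y k)))) \<le> e I"
      proof
        fix J assume J: "J \<in> {J. J \<subseteq> C - {x} \<and> card J = L - 1}"
        define I where "I = {j\<in>A - B. cw j \<in> insert x J}"
        have IM: "I \<subseteq> {..<M}" using sub by (auto simp: I_def)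
        have im: "cw ` I = insert x J" using J x unfolding I_def C_def by blast
        have "finite J" using J finC by (auto intro: finite_subset[of J C])
        then have "card (insert x J) = L" using J L by (subst card_insert_disjoint) auto
        then have cI: "card I = L" using card_image[OF inj_on_subset[OF inj IM]] im by simp
        have eI: "exp (- (\<beta> * (\<Sum>k<n. spread (insert x J) (\<lambda>y. y k)))) = e I"
          unfolding im[symmetric] e_def using spread_cw[OF IM] by simp
        show "\<exists>I\<in>{I. I \<subseteq> A \<and> card I = L \<and> i \<in> I}.
          cw ` I - {x} = J \<and> exp (- (\<beta> * (\<Sum>k<n. spread (insert x J) (\<lambda>y. y k)))) \<le> e I"
        proof (intro bexI conjI)
          show "cw ` I - {x} = J" using im J by blast
          show "exp (- (\<beta> * (\<Sum>k<n. spread (insert x J) (\<lambda>y. y k)))) \<le> e I" using eI by simp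
          show "I \<in> {I. I \<subseteq> A \<and> card I = L \<and> i \<in> I}" using cI i unfolding I_def by blast
        qed
      qed
    qed
    also have "w i \<le> 4 * L * a / M" using i by (auto simp: B_def)
    finally show ?thesis .
  qed
  show thesis
  proof (rule that[of C])
    show "finite C" by (rule finC)
    show "C \<subseteq> real_space n" by (auto simp: C_def cw_def real_space_def split: if_splits)
    show "(\<Sum>k<n. (x k)\<^sup>2) \<le> n * p" if "x \<in> C" for x
      using that by (auto simp: C_def A_def cw_k)
    show "card C \<le> M" unfolding cardC using card_mono[OF finite_lessThan sub] by simp
    show "M \<le> 2 * card C" using M_le unfolding cardC by linarith
  qed (rule sum_C)
qed

lemma avg_list_error_prob_le:
  assumes "\<sigma> > 0" and "\<rho> \<ge> 1" and "2 * \<sigma>\<^sup>2 * \<beta> * \<rho> = 1"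
    and "finite C" and "C \<noteq> {}"
    and bound: "\<And>x. x \<in> C \<Longrightarrow> (\<Sum>J | J \<subseteq> C - {x} \<and> card J = l.
        exp (- (\<beta> * (\<Sum>k<n. spread (insert x J) (\<lambda>y. y k))))) \<le> S"
  shows "avg_list_error_prob n \<sigma> l C \<le> S powr \<rho>"
proof -
  have "list_error_prob n \<sigma> l C x \<le> S powr \<rho>" if x: "x \<in> C" for x
  proof -
    let ?\<J> = "{J. J \<subseteq> C - {x} \<and> card J = l}"
    let ?w = "\<lambda>J. \<beta> * (\<Sum>k<n. spread (insert x J) (\<lambda>y. y k))"
    have fin: "finite ?\<J>" by (rule finite_subset[of _ "Pow C"]) (use assms(4) in auto)
    have exps: "- u / (2 * \<sigma>\<^sup>2) = - (\<rho> * (\<beta> * u))" for u :: real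
    proof -
      have "\<rho> * \<beta> = 1 / (2 * \<sigma>\<^sup>2)" using assms(1,3) by (simp add: field_simps)
      then show ?thesis by (simp add: mult.assoc[symmetric])
    qed
    have "list_error_prob n \<sigma> l C x \<le> (\<Sum>J\<in>?\<J>. exp (- (\<rho> * ?w J)))"
      using list_error_prob_le_sum_exp_spread[OF assms(1,4), of n l x] unfolding exps .
    also have "\<dots> \<le> (\<Sum>J\<in>?\<J>. exp (- ?w J)) powr \<rho>"
      by (rule sum_exp_le_powr_sum_exp[OF fin assms(2)])
    also have "\<dots> \<le> S powr \<rho>"
      using bound[OF x] assms(2) by (intro powr_mono2) (auto intro: sum_nonneg)
    finally show ?thesis .
  qed
  then have "(\<Sum>x\<in>C. list_error_prob n \<sigma> l C x) \<le> card C * S powr \<rho>"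
    using sum_mono[of C "list_error_prob n \<sigma> l C" "\<lambda>_. S powr \<rho>"] by simp
  then show ?thesis
    using assms(4,5) by (simp add: avg_list_error_prob_def divide_le_eq mult.commute card_gt_0_iff)
qed

text \<open>With $M \approx e^{nR}$, Gaussian entries of variance $\tau^2$ and the thresholds $a = 4 M^L \gamma^n$ and $M/4$,
each of the three expected functionals of the random codebook contributes at most $1/4$ for large $n$;
the parameter $\mu$ of the third one is free and is chosen so large that $M^2$ pairs do no harm.
After expurgation every codeword has weight at most of order $M^{L-1} \gamma^n$.\<close>
lemma eventually_awgn_list_code:
  fixes \<sigma> \<tau> \<beta> \<rho> s q p \<theta> \<eta> R \<gamma> hi lo :: real and L :: nat
  defines "\<gamma> \<equiv> exp (- (L * s * q)) / (sqrt (1 - 2 * s * \<tau>\<^sup>2) * sqrt (1 - 2 * s * \<tau>\<^sup>2 + 2 * \<beta> * \<tau>\<^sup>2 / L) ^ (L - 1))"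
    and "hi \<equiv> exp (- (\<theta> * p)) / sqrt (1 - 2 * \<theta> * \<tau>\<^sup>2)"
    and "lo \<equiv> exp (- (\<eta> * q)) / sqrt (1 - 2 * \<eta> * \<tau>\<^sup>2)"
  assumes pos: "\<sigma> > 0" "\<tau> > 0" "\<beta> > 0" "R > 0" "L > 0" and \<rho>: "\<rho> \<ge> 1" "2 * \<sigma>\<^sup>2 * \<beta> * \<rho> = 1"
    and s: "s \<ge> 0" "2 * s * \<tau>\<^sup>2 < 1" and \<theta>: "\<theta> \<ge> 0" "2 * \<theta> * \<tau>\<^sup>2 < 1" "hi < 1" and \<eta>: "\<eta> \<le> 0" "lo < 1"
  shows "\<forall>\<^sub>F n in sequentially. \<exists>C. awgn_code n p C \<and> R - ln 4 / n \<le> code_rate n C \<and> code_rate n C \<le> R \<and>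
    avg_list_error_prob n \<sigma> (L - 1) C \<le> (16 * L * (exp ((L - 1) * R) * \<gamma>) ^ n) powr \<rho>"
proof -
  have \<eta>2: "2 * \<eta> * \<tau>\<^sup>2 < 1"
    using \<eta>(1) mult_nonpos_nonneg[of \<eta> "\<tau>\<^sup>2"] by simp
  have v: "1 - 2 * s * \<tau>\<^sup>2 + 2 * \<beta> * \<tau>\<^sup>2 / L > 0"
    using s pos by (intro add_pos_pos) auto
  have \<gamma>: "\<gamma> > 0" using s v unfolding \<gamma>_def by (intro divide_pos_pos mult_pos_pos) auto
  have "hi \<ge> 0" "lo \<ge> 0" using \<theta> \<eta>2 by (auto simp: hi_def lo_def)
  then have "(\<lambda>n. 4 * (hi ^ n + lo ^ n)) \<longlonglongrightarrow> 4 * (0 + 0)"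
    using \<theta> \<eta> by (intro tendsto_intros LIMSEQ_power_zero) auto
  then have ev1: "\<forall>\<^sub>F n in sequentially. 4 * (hi ^ n + lo ^ n) < 1 / 4"
    by (rule order_tendstoD) simp
  have "(\<lambda>n. exp (- R) ^ n) \<longlonglongrightarrow> 0" using pos by (intro LIMSEQ_power_zero) auto
  then have ev2: "\<forall>\<^sub>F n in sequentially. exp (- R) ^ n < 1 / 4"
    by (rule order_tendstoD) simp
  (* Makes the one-coordinate factor for coincidences equal to exp (-3R), against M^2 <= exp (2nR) pairs. *)
  define \<mu> where "\<mu> = (exp (6 * R) - 1) / \<tau>\<^sup>2"
  have \<mu>: "\<mu> > 0" using pos by (simp add: \<mu>_def)
  have dup: "1 / sqrt (1 + \<mu> * \<tau>\<^sup>2) = exp (- 3 * R)"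
  proof -
    have "1 + \<mu> * \<tau>\<^sup>2 = (exp (3 * R))\<^sup>2"
      using pos by (simp add: \<mu>_def flip: exp_double)
    then show ?thesis by (simp add: exp_minus divide_inverse)
  qed
  show ?thesis
    using ev1 ev2 eventually_gt_at_top[of 0]
  proof eventually_elim
    case (elim n)
    define M where "M = nat \<lfloor>exp (n * R)\<rfloor>"
    have e1: "exp (n * R) \<ge> 1" using pos by simp
    have M_eq: "real M = of_int \<lfloor>exp (n * R)\<rfloor>"
      using e1 by (simp add: M_def)
    then have M_le: "M \<le> exp (n * R)" by simp
    have "1 \<le> \<lfloor>exp (n * R)\<rfloor>" using e1 by simp
    then have M1: "M \<ge> 1" using M_eq by linarith
    then have M_ge: "exp (n * R) \<le> 2 * M" using M_eq by linarith
    define a where "a = 4 * M ^ L * \<gamma> ^ n"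
    have a: "a > 0" using M1 \<gamma> by (simp add: a_def)
    have t1: "(M choose L) * \<gamma> ^ n / a \<le> 1 / 4"
    proof -
      have "M choose L \<le> M ^ L"
        by (cases "L \<le> M") (auto simp: binomial_le_pow binomial_eq_0)
      then have "real (M choose L) \<le> real M ^ L" by (metis of_nat_le_iff of_nat_power)
      then show ?thesis using M1 \<gamma> by (simp add: a_def divide_le_eq)
    qed
    have t2: "M * (hi ^ n + lo ^ n) / (M / 4) < 1 / 4" using elim(1) M1 by simp
    have t3: "(M choose 2) * (1 / sqrt (1 + \<mu> * \<tau>\<^sup>2)) ^ n < 1 / 4"
    proof -
      have "M choose 2 \<le> M ^ 2"
        by (cases "2 \<le> M") (auto simp: binomial_le_pow binomial_eq_0)
      then have "real (M choose 2) \<le> (real M)\<^sup>2" by (metis of_nat_le_iff of_nat_power)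
      also have "\<dots> \<le> (exp (n * R))\<^sup>2" using M_le by (intro power_mono) auto
      finally have "(M choose 2) * (1 / sqrt (1 + \<mu> * \<tau>\<^sup>2)) ^ n \<le> (exp (n * R))\<^sup>2 * exp (- 3 * R) ^ n"
        unfolding dup by (intro mult_right_mono) auto
      also have "\<dots> = exp (- R) ^ n"
        by (simp add: algebra_simps flip: exp_of_nat_mult exp_double exp_add)
      finally show ?thesis using elim(2) by simp
    qed
    obtain X where X: "(\<Sum>I | I \<subseteq> {..<M} \<and> card I = L. \<Prod>k<n. exp (- \<beta> * spread I (X k) + s * (\<Sum>i\<in>I. (X k i)\<^sup>2 - q))) < a"
      "(\<Sum>i<M. \<Prod>k<n. exp (\<theta> * ((X k i)\<^sup>2 - p))) + (\<Sum>i<M. \<Prod>k<n. exp (\<eta> * ((X k i)\<^sup>2 - q))) < M / 4"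
      "(\<Sum>I | I \<subseteq> {..<M} \<and> card I = 2. \<Prod>k<n. exp (- \<mu> * spread I (X k))) < 1"
    proof (rule random_codebook[of \<tau> \<beta> \<mu> L a "M / 4" s \<theta> \<eta> M q n p])
      show "(M choose L) * (exp (- (L * s * q)) / (sqrt (1 - 2 * s * \<tau>\<^sup>2) * sqrt (1 - 2 * s * \<tau>\<^sup>2 + 2 * \<beta> * \<tau>\<^sup>2 / L) ^ (L - 1))) ^ n / a
        + M * ((exp (- (\<theta> * p)) / sqrt (1 - 2 * \<theta> * \<tau>\<^sup>2)) ^ n + (exp (- (\<eta> * q)) / sqrt (1 - 2 * \<eta> * \<tau>\<^sup>2)) ^ n) / (M / 4)
        + (M choose 2) * (1 / sqrt (1 + \<mu> * \<tau>\<^sup>2)) ^ n < 1"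
        using t1 t2 t3 unfolding \<gamma>_def hi_def lo_def by linarith
    qed (use pos s \<theta> \<eta>2 \<mu> a M1 in auto)
    obtain C where C: "finite C" "C \<subseteq> real_space n" "\<And>x. x \<in> C \<Longrightarrow> (\<Sum>k<n. (x k)\<^sup>2) \<le> n * p"
      "card C \<le> M" "M \<le> 2 * card C"
      "\<And>x. x \<in> C \<Longrightarrow> (\<Sum>J | J \<subseteq> C - {x} \<and> card J = L - 1.
          exp (- (\<beta> * (\<Sum>k<n. spread (insert x J) (\<lambda>y. y k))))) \<le> 4 * L * a / M"
      using expurgated_code[OF pos(5) elim(3) _ s(1) \<theta>(1) \<eta>(1) X] M1 by auto
    have C0: "card C > 0" "C \<noteq> {}" using C(5) M1 by auto
    have "avg_list_error_prob n \<sigma> (L - 1) C \<le> (4 * L * a / M) powr \<rho>"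
      by (rule avg_list_error_prob_le[OF pos(1) \<rho> C(1) C0(2) C(6)])
    also have "\<dots> \<le> (16 * L * (exp ((L - 1) * R) * \<gamma>) ^ n) powr \<rho>"
    proof (intro powr_mono2)
      obtain K where K: "L = Suc K" using pos(5) by (cases L) auto
      have "4 * L * a / M = 16 * L * \<gamma> ^ n * real M ^ K"
        using M1 by (simp add: a_def K)
      also have "\<dots> \<le> 16 * L * \<gamma> ^ n * exp (n * R) ^ K"
        using M_le \<gamma> by (intro mult_left_mono power_mono) auto
      also have "\<dots> = 16 * L * (exp ((L - 1) * R) * \<gamma>) ^ n"
        by (simp add: K power_mult_distrib algebra_simps flip: exp_of_nat_mult)
      finally show "4 * L * a / M \<le> 16 * L * (exp ((L - 1) * R) * \<gamma>) ^ n" .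
    qed (use \<rho> a in auto)
    finally have err: "avg_list_error_prob n \<sigma> (L - 1) C \<le> (16 * L * (exp ((L - 1) * R) * \<gamma>) ^ n) powr \<rho>" .
    have code: "awgn_code n p C"
      using C(1-3) C0(2) unfolding awgn_code_def L2_set_def by auto
    have "card C \<le> exp (n * R)" using C(4) M_le by linarith
    then have "ln (card C) \<le> ln (exp (n * R))" using C0 by (subst ln_le_cancel_iff) auto
    then have "ln (card C) \<le> n * R" by simp
    then have up: "code_rate n C \<le> R" using elim(3) by (simp add: code_rate_def divide_le_eq mult.commute)
    have "exp (n * R) \<le> 4 * card C" using C(5) M_ge by linarith
    then have "n * R \<le> ln (4 * card C)" using C0 by (subst ln_ge_iff) auto
    then have "n * R - ln 4 \<le> ln (card C)" using C0 by (simp add: ln_mult)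
    then have "(n * R - ln 4) / n \<le> code_rate n C"
      unfolding code_rate_def by (rule divide_right_mono) simp
    then have lw: "R - ln 4 / n \<le> code_rate n C" using elim(3) by (simp add: diff_divide_distrib)
    show ?case using code err up lw by blast
  qed
qed

section \<open>The parameter of the exponent\<close>

lemma exponent_param_gt:
  assumes "exponent_param L R t" and "L \<ge> 2"
  shows "real L * t - 1 > 0" and "t > 0" and "t \<le> 1"
proof -
  have t: "1 / real L \<le> t" "t \<le> 1" and eq: "(real L * t - 1) * exp (2 * R) = (real L - 1) * t powr (real L / (real L - 1))"
    using assms(1) by (auto simp: exponent_param_def)
  show "t \<le> 1" by fact
  have "0 < 1 / real L" using assms(2) by simp
  then show "t > 0" using t by linarith
  then have "(real L * t - 1) * exp (2 * R) > 0" unfolding eq using assms(2) by simp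
  then show "real L * t - 1 > 0" by (simp add: zero_less_mult_iff)
qed

text \<open>The logarithmic form of the equation for $t$, in which $R$ is an explicit function of $t$. With
$v = (L-1)t/(Lt-1)$ it reads $2(L-1)R = (L-1)\ln v + \ln t$.\<close>
lemma exponent_param_iff_rate:
  assumes "L \<ge> 2" and "real L * t - 1 > 0" and "t > 0" and "t \<le> 1"
  shows "exponent_param L R t \<longleftrightarrow>
    2 * R = ln ((real L - 1) * t / (real L * t - 1)) + ln t / (real L - 1)"
proof -
  have L1: "real L - 1 > 0" using assms(1) by simp
  have in_range: "t \<in> {1 / real L..1}" using assms by (simp add: field_simps)
  have exponent: "real L / (real L - 1) = 1 + 1 / (real L - 1)" using L1 by (simp add: field_simps)
  have "(real L - 1) * t powr (real L / (real L - 1))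
      = (real L * t - 1) * exp (ln ((real L - 1) * t / (real L * t - 1)) + ln t / (real L - 1))"
    using assms L1 by (simp add: exponent powr_add powr_def[of t "1 / _"] exp_add)
  then have "exponent_param L R t \<longleftrightarrow> exp (2 * R) = exp (ln ((real L - 1) * t / (real L * t - 1)) + ln t / (real L - 1))"
    using in_range assms(2) unfolding exponent_param_def by (metis less_irrefl mult_cancel_left)
  then show ?thesis by simp
qed

lemma rate_strict_decreasing:
  fixes x y :: real
  assumes "L \<ge> 2" and "real L * x - 1 > 0" and "x > 0" and "x < y" and "y \<le> 1"
  shows "ln ((real L - 1) * y / (real L * y - 1)) + ln y / (real L - 1)
    < ln ((real L - 1) * x / (real L * x - 1)) + ln x / (real L - 1)"
proof -
  define h where "h t = ln (real L - 1) + real L / (real L - 1) * ln t - ln (real L * t - 1)" for t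
  have L1: "real L - 1 > 0" using assms(1) by simp
  have pos: "real L * t - 1 > 0" "t > 0" if "x \<le> t" for t
    using assms that mult_left_mono[OF that, of "real L"] by linarith+
  have h: "ln ((real L - 1) * t / (real L * t - 1)) + ln t / (real L - 1) = h t" if "x \<le> t" for t
  proof -
    have e: "real L / (real L - 1) = 1 + 1 / (real L - 1)" using L1 by (simp add: field_simps)
    have "ln ((real L - 1) * t / (real L * t - 1)) = ln (real L - 1) + ln t - ln (real L * t - 1)"
      using pos[OF that] assms(1) by (simp add: ln_div ln_mult)
    then show ?thesis unfolding h_def e by (simp add: algebra_simps)
  qed
  have deriv: "(h has_real_derivative (real L / (real L - 1) / t - real L / (real L * t - 1))) (at t)" if "x \<le> t" for t
    unfolding h_def using pos[OF that] assms(1) by (auto intro!: derivative_eq_intros)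
  have "h y < h x"
  proof (rule DERIV_neg_imp_decreasing_open[OF assms(4)])
    fix t assume t: "x < t" "t < y"
    have "real L / (real L - 1) / t - real L / (real L * t - 1) = - (real L * (1 - t)) / ((real L - 1) * t * (real L * t - 1))"
      using pos[of t] t L1 by (simp add: divide_simps) (simp add: algebra_simps)
    also have "\<dots> < 0"
      using pos[of t] t L1 assms by (intro divide_neg_pos) auto
    finally show "\<exists>d. (h has_real_derivative d) (at t) \<and> d < 0" using deriv[of t] t by auto
  next
    show "continuous_on {x..y} h"
      using DERIV_isCont[OF deriv] by (intro continuous_at_imp_continuous_on ballI) simp
  qed
  then show ?thesis using h[of x] h[of y] assms(4) by simp
qed

lemma exponent_param_ex1:
  assumes "L \<ge> 2" and "R \<ge> 0"
  shows "\<exists>t. exponent_param L R t \<and> (\<forall>s. exponent_param L R s \<longrightarrow> s = t)"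
proof -
  define f where "f t = (real L * t - 1) * exp (2 * R) - (real L - 1) * t powr (real L / (real L - 1))" for t
  have L: "1 / real L > 0" "1 / real L \<le> 1" using assms by auto
  have "continuous_on {1 / real L..1} f"
    unfolding f_def using L by (intro continuous_intros) auto
  moreover have "f (1 / real L) \<le> 0" using assms by (simp add: f_def)
  moreover have "f 1 \<ge> 0" using assms by (simp add: f_def)
  ultimately obtain t where t: "t \<in> {1 / real L..1}" "f t = 0"
    using IVT'[of f "1 / real L" 0 1] L by auto
  then have ex: "exponent_param L R t" by (simp add: exponent_param_def f_def)
  have "\<not> x < y" if "exponent_param L R x" "exponent_param L R y" for x y
    using rate_strict_decreasing[OF assms(1) exponent_param_gt(1,2)[OF that(1) assms(1)], of y]
      exponent_param_gt[OF that(1) assms(1)] exponent_param_gt[OF that(2) assms(1)]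
      exponent_param_iff_rate[of L x R] exponent_param_iff_rate[of L y R] assms that by fastforce
  then show ?thesis using ex by (metis linorder_neqE)
qed

text \<open>This is where the restriction on the rate enters. Equality in the conclusion is a quadratic equation
for $t$ whose positive root $t_x$ is the argument of the second logarithm in the definition of the
critical rate, while the argument of the first one is $(L-1)t_x/(Lt_x-1)$. Thus the critical rate is
the rate that belongs to $t_x$, and by monotonicity smaller rates have $t \ge t_x$.\<close>
lemma expurgation_parameter_ge_1:
  fixes snr R t :: real
  assumes "L \<ge> 2" and "snr > 0" and "R \<le> rate_x L snr" and "exponent_param L R t"
  shows "real L ^ 2 * t * (1 - t) \<le> snr * (real L * t - 1)"
proof -
  define D where "D = sqrt ((real L)\<^sup>2 + snr\<^sup>2 - 2 * snr * (real L - 2))"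
  have L1: "real L - 1 > 0" "real L > 0" using assms(1) by auto
  have rad: "(real L)\<^sup>2 + snr\<^sup>2 - 2 * snr * (real L - 2) = (real L - snr)\<^sup>2 + 4 * snr"
    by (simp add: power2_eq_square algebra_simps)
  have D0: "D \<ge> 0" unfolding D_def rad using assms(2) by (simp add: add_nonneg_nonneg)
  have D2: "D\<^sup>2 = (real L - snr)\<^sup>2 + 4 * snr"
    unfolding D_def rad using assms(2) by (subst real_sqrt_pow2) (auto simp: add_nonneg_nonneg)
  (* The positive root of L^2 u^2 - (L - snr) L u - snr. *)
  define tx where "tx = (D + real L - snr) / (2 * real L)"
  have quad: "real L ^ 2 * u ^ 2 - (real L - snr) * real L * u - snr
      = (real L * u - (real L - snr + D) / 2) * (real L * u - (real L - snr - D) / 2)" for u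
  proof -
    have expand: "(w - (c + D) / 2) * (w - (c - D) / 2) = w\<^sup>2 - c * w + (c\<^sup>2 - D\<^sup>2) / 4" for w c :: real
      by (simp add: power2_eq_square field_simps)
    show ?thesis
      unfolding expand[of "real L * u" "real L - snr"] D2 by (simp add: power2_eq_square algebra_simps)
  qed
  have Ltx: "real L * tx = (real L - snr + D) / 2" using L1 by (simp add: tx_def)
  have D_gt: "D > \<bar>real L - snr\<bar>"
  proof -
    have "\<bar>real L - snr\<bar>\<^sup>2 < D\<^sup>2" unfolding D2 using assms(2) by simp
    then show ?thesis using D0 by (rule power2_less_imp_less)
  qed
  have D_gt2: "D > snr + 2 - real L"
  proof (cases "snr + 2 - real L \<ge> 0")
    case True
    have "(snr + 2 - real L)\<^sup>2 < D\<^sup>2"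
      unfolding D2 using L1 by (simp add: power2_eq_square algebra_simps)
    then show ?thesis using D0 by (rule power2_less_imp_less)
  next
    case False then show ?thesis using D0 by simp
  qed
  have D_le: "D \<le> real L + snr"
  proof (rule power2_le_imp_le)
    have "snr * 4 \<le> snr * (4 * real L)" using assms by simp
    then show "D\<^sup>2 \<le> (real L + snr)\<^sup>2" unfolding D2 by (simp add: power2_eq_square algebra_simps)
  qed (use L1 assms in simp)
  have tx: "real L * tx - 1 > 0" "tx > 0" "tx \<le> 1"
    using D_gt2 D_gt D_le L1 unfolding Ltx by (auto simp: tx_def)
  have vx: "(real L - 1) * tx / (real L * tx - 1) = (D + real L + snr) / (2 * real L)"
  proof -
    have "real L * ((real L - 1) * tx) = (D + real L + snr) / 2 * (real L * tx - 1)"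
      using D2 unfolding mult.left_commute[of "real L"] Ltx by (simp add: power2_eq_square field_simps)
    then show ?thesis using tx L1 by (simp add: field_simps)
  qed
  have t: "real L * t - 1 > 0" "t > 0" "t \<le> 1" by (rule exponent_param_gt[OF assms(4,1)])+
  have rate_t: "2 * R = ln ((real L - 1) * t / (real L * t - 1)) + ln t / (real L - 1)"
    using exponent_param_iff_rate[OF assms(1) t] assms(4) by simp
  have "2 * rate_x L snr = ln ((real L - 1) * tx / (real L * tx - 1)) + ln tx / (real L - 1)"
    unfolding vx by (simp add: rate_x_def D_def[symmetric] tx_def)
  then have "tx \<le> t"
    using rate_strict_decreasing[OF assms(1) t(1,2) _ tx(3)] assms(3) rate_t by force
  then have "real L * t \<ge> (real L - snr + D) / 2" unfolding Ltx[symmetric] using L1 by simp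
  moreover have "real L * t - (real L - snr - D) / 2 \<ge> 0"
  proof -
    have "(real L - snr - D) / 2 \<le> (real L - snr + D) / 2" using D0 by simp
    then show ?thesis using calculation by simp
  qed
  ultimately have "0 \<le> real L ^ 2 * t ^ 2 - (real L - snr) * real L * t - snr"
    unfolding quad by (intro mult_nonneg_nonneg) auto
  then show ?thesis by (simp add: power2_eq_square algebra_simps)
qed

section \<open>Codes close to the exponent\<close>

text \<open>A form of $1 + x < e^x$ that covers both Chernoff bounds for the norm of a Gaussian vector: with
$r > 1$ it handles norms that are too large, with $1/r$ norms that are too small.\<close>
lemma sqrt_less_exp_half:
  fixes r :: real
  assumes "r > 0" and "r \<noteq> 1"
  shows "sqrt r < exp ((r - 1) / 2)"
proof -
  have "0 < (r - 1)\<^sup>2" using assms by simp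
  then have "r < ((r + 1) / 2)\<^sup>2" by (simp add: power2_eq_square field_simps)
  then have "sqrt r < (r + 1) / 2" using assms by (intro real_less_lsqrt) auto
  also have "\<dots> = 1 + (r - 1) / 2" by (simp add: field_simps)
  also have "\<dots> \<le> exp ((r - 1) / 2)" by (rule exp_ge_add_one_self)
  finally show ?thesis .
qed

lemma normalized_neg_ln_ge:
  assumes "0 \<le> p" and "p \<le> (c * x ^ n) powr \<rho>" and "n > 0" and "c > 0" and "x > 0"
  shows "ereal (- \<rho> * ln x - \<rho> * ln c / n) \<le> normalized_neg_ln n p"
proof (cases "p = 0")
  case False
  then have "ln p \<le> ln ((c * x ^ n) powr \<rho>)" using assms by (subst ln_le_cancel_iff) auto
  also have "\<dots> = \<rho> * (ln c + n * ln x)"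
    using assms by (simp add: ln_powr ln_mult ln_realpow)
  finally have "ln p / n \<le> \<rho> * (ln c + n * ln x) / n" using assms(3) by (intro divide_right_mono) auto
  also have "\<rho> * (ln c + n * ln x) / n = \<rho> * ln x + \<rho> * ln c / n"
    using assms(3) by (simp add: field_simps)
  finally show ?thesis using False by (simp add: normalized_neg_ln_def)
qed (simp add: normalized_neg_ln_def)

text \<open>Codewords are drawn with variance $P/r$ and kept if $n P/r^2 \le \|x\|^2 \le n P$, where $r > 1$; then $r \to 1$.
The choice of $\beta$, $\rho$ and $s$ is the saddle point of the exponent
$\rho\,(-\ln\gamma - (L-1)R)$ at $r = 1$: maximizing over the tilt and over $\beta$, with $2\sigma^2\beta\rho = 1$, gives
$1 - 2 s P = t$ and $1 - 2 s P + 2 \beta P / L = v$ with $v = (L-1)t/(Lt-1)$. At that point the equation for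
$t$ cancels the logarithms, and $\rho L(1-t)/2$ is left, which is the claimed exponent.\<close>
lemma eventually_awgn_code_near_exponent:
  fixes P \<sigma> R t \<epsilon> snr :: real and L :: nat
  assumes "P > 0" and "\<sigma> > 0" and "L \<ge> 2" and snr: "snr = P / \<sigma>\<^sup>2"
    and "R > 0" and "R \<le> rate_x L snr" and t: "exponent_param L R t" and "\<epsilon> > 0"
  shows "\<forall>\<^sub>F n in sequentially. \<exists>C. awgn_code n P C \<and> \<bar>code_rate n C - R\<bar> \<le> \<epsilon> \<and>
    ereal (snr * (real L * t - 1) / (2 * real L * t) - \<epsilon>) \<le> normalized_neg_ln n (avg_list_error_prob n \<sigma> (L - 1) C)"
proof -
  have L1: "real L - 1 > 0" "real L > 0" "L > 0" using assms(3) by auto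
  have snr0: "snr > 0" using assms by simp
  note t_range = exponent_param_gt[OF t assms(3)]
  have rate: "2 * R = ln ((real L - 1) * t / (real L * t - 1)) + ln t / (real L - 1)"
    using exponent_param_iff_rate[OF assms(3) t_range] t by simp
  have t1: "t < 1" using rate t_range L1 \<open>R > 0\<close> by (cases "t = 1") auto
  define v where "v = (real L - 1) * t / (real L * t - 1)"
  have vt: "v - t = real L * t * (1 - t) / (real L * t - 1)"
    using t_range unfolding v_def by (simp add: field_simps)
  have vt0: "v - t > 0" unfolding vt using t_range t1 L1 by simp
  define \<beta> where "\<beta> = real L * (v - t) / (2 * P)"
  define \<rho> where "\<rho> = snr * (real L * t - 1) / (real L ^ 2 * t * (1 - t))"
  have \<beta>: "\<beta> > 0" using vt0 L1 assms(1) by (simp add: \<beta>_def)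
  have \<rho>: "\<rho> \<ge> 1"
    using expurgation_parameter_ge_1[OF assms(3) snr0 assms(6) t] t_range t1 L1 by (simp add: \<rho>_def le_divide_eq)
  have \<beta>\<rho>: "2 * \<sigma>\<^sup>2 * \<beta> * \<rho> = 1"
    unfolding \<beta>_def vt \<rho>_def snr using assms(1,2) t_range t1 L1 by (simp add: power2_eq_square)
  define \<gamma> where "\<gamma> r = exp (- (real L * (1 - t) / (2 * r))) / (sqrt t * sqrt (t + (v - t) / r) ^ (L - 1))" for r
  (* g r is the exponent achieved with the slack r; it tends to the claimed one as r decreases to 1. *)
  define g where "g r = \<rho> * (real L * (1 - t) / (2 * r) + ln t / 2 + (real L - 1) / 2 * ln (t + (v - t) / r) - (real L - 1) * R)" for r
  have \<gamma>_pos: "\<gamma> r > 0" and g_eq: "- \<rho> * ln (exp ((L - 1) * R) * \<gamma> r) = g r" if "r > 1" for r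
  proof -
    have w: "t + (v - t) / r > 0" using t_range vt0 that by (simp add: add_pos_pos)
    show pos: "\<gamma> r > 0" using w t_range by (simp add: \<gamma>_def)
    have "ln (\<gamma> r) = - (real L * (1 - t) / (2 * r)) - (ln t / 2 + (real L - 1) * (ln (t + (v - t) / r) / 2))"
      unfolding \<gamma>_def using w t_range L1 by (simp add: ln_div ln_mult ln_realpow ln_sqrt)
    moreover have "ln (exp ((L - 1) * R) * \<gamma> r) = (real L - 1) * R + ln (\<gamma> r)"
      using pos assms(3) by (simp add: ln_mult)
    moreover have "- \<rho> * (A + (- B - (C + K * (W / 2)))) = \<rho> * (B + C + K / 2 * W - A)" for A B C K W
      by (simp add: algebra_simps)
    ultimately show "- \<rho> * ln (exp ((L - 1) * R) * \<gamma> r) = g r"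
      unfolding g_def by simp
  qed
  define E where "E = snr * (real L * t - 1) / (2 * real L * t)"
  have "(g \<longlongrightarrow> g 1) (at_right 1)"
    unfolding g_def using t_range vt0 by (intro tendsto_intros) auto
  moreover have "g 1 = E"
  proof -
    have "(real L - 1) * R = ((real L - 1) * ln v + ln t) / 2"
      using rate L1 unfolding v_def by (simp add: field_simps)
    then have "real L * (1 - t) / 2 + ln t / 2 + (real L - 1) / 2 * ln v - (real L - 1) * R = real L * (1 - t) / 2"
      by (simp add: field_simps)
    then have "g 1 = \<rho> * (real L * (1 - t) / 2)" by (simp add: g_def)
    then show ?thesis
      unfolding \<rho>_def E_def using t_range t1 L1 by (simp add: power2_eq_square)
  qed
  ultimately have "\<forall>\<^sub>F r in at_right 1. E - \<epsilon> / 2 < g r"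
    using assms(8) by (intro order_tendstoD) auto
  then have "\<forall>\<^sub>F r in at_right 1. E - \<epsilon> / 2 < g r \<and> 1 < r"
    by (intro eventually_conj eventually_at_right_less)
  then obtain r where r: "E - \<epsilon> / 2 < g r" "1 < r"
    using eventually_happens'[OF trivial_limit_at_right_real] by blast
  (* theta and eta are the optimal Chernoff parameters for the events |x|^2 > nP and |x|^2 < nP/r^2. *)
  define \<tau> where "\<tau> = sqrt (P / r)"
  define s where "s = (1 - t) * r / (2 * P)"
  define q where "q = P / r\<^sup>2"
  define \<theta> where "\<theta> = (r - 1) / (2 * P)"
  define \<eta> where "\<eta> = (1 - r) * r / (2 * P)"
  have \<tau>: "\<tau> > 0" "\<tau>\<^sup>2 = P / r" using assms(1) r(2) by (auto simp: \<tau>_def)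
  have s: "s \<ge> 0" "2 * s * \<tau>\<^sup>2 = 1 - t" "L * s * q = real L * (1 - t) / (2 * r)"
    unfolding \<tau>(2) using assms(1) r(2) t1 by (auto simp: s_def q_def power2_eq_square)
  have \<beta>_var: "2 * \<beta> * \<tau>\<^sup>2 / L = (v - t) / r"
    unfolding \<tau>(2) \<beta>_def using assms(1) r(2) L1 by (simp add: field_simps)
  have \<theta>: "\<theta> \<ge> 0" "2 * \<theta> * \<tau>\<^sup>2 = 1 - 1 / r" "\<theta> * P = (r - 1) / 2"
    unfolding \<tau>(2) using assms(1) r(2) by (auto simp: \<theta>_def field_simps)
  have \<eta>: "\<eta> \<le> 0" "2 * \<eta> * \<tau>\<^sup>2 = 1 - r" "\<eta> * q = (1 / r - 1) / 2"
    unfolding \<tau>(2) using assms(1) r(2) by (auto simp: \<eta>_def q_def field_simps power2_eq_square mult_nonpos_nonneg divide_nonpos_pos)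
  have hi: "exp (- (\<theta> * P)) / sqrt (1 - 2 * \<theta> * \<tau>\<^sup>2) < 1"
    unfolding \<theta> using sqrt_less_exp_half[of r] r(2) by (simp add: exp_minus real_sqrt_divide field_simps)
  have lo: "exp (- (\<eta> * q)) / sqrt (1 - 2 * \<eta> * \<tau>\<^sup>2) < 1"
    unfolding \<eta> using sqrt_less_exp_half[of "1 / r"] r(2)
    by (simp add: real_sqrt_divide exp_minus divide_simps mult.commute)
  have \<gamma>_eq: "exp (- (L * s * q)) / (sqrt (1 - 2 * s * \<tau>\<^sup>2) * sqrt (1 - 2 * s * \<tau>\<^sup>2 + 2 * \<beta> * \<tau>\<^sup>2 / L) ^ (L - 1)) = \<gamma> r"
    unfolding s \<beta>_var \<gamma>_def by simp
  have codes: "\<forall>\<^sub>F n in sequentially. \<exists>C. awgn_code n P C \<and> R - ln 4 / n \<le> code_rate n C \<and> code_rate n C \<le> R \<and>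
    avg_list_error_prob n \<sigma> (L - 1) C \<le> (16 * L * (exp ((L - 1) * R) * \<gamma> r) ^ n) powr \<rho>"
    unfolding \<gamma>_eq[symmetric]
    by (rule eventually_awgn_list_code[OF assms(2) \<tau>(1) \<beta> assms(5) L1(3) \<rho> \<beta>\<rho> s(1) _ \<theta>(1) _ hi \<eta>(1) lo])
      (use s \<theta> t_range r in auto)
  have small: "\<forall>\<^sub>F n in sequentially. c / real n < \<delta>" if "\<delta> > 0" for c \<delta> :: real
    using that lim_const_over_n[of c] by (intro order_tendstoD) auto
  have half: "\<epsilon> / 2 > 0" using assms(8) by simp
  show ?thesis
    using codes small[OF assms(8), of "ln 4"] small[OF half, of "\<rho> * ln (16 * L)"] eventually_gt_at_top[of 0]
    unfolding E_def[symmetric]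
  proof eventually_elim
    case (elim n)
    then obtain C where C: "awgn_code n P C" "R - ln 4 / n \<le> code_rate n C" "code_rate n C \<le> R"
      "avg_list_error_prob n \<sigma> (L - 1) C \<le> (16 * L * (exp ((L - 1) * R) * \<gamma> r) ^ n) powr \<rho>" by blast
    have "0 \<le> avg_list_error_prob n \<sigma> (L - 1) C"
      by (auto simp: avg_list_error_prob_def list_error_prob_def intro!: divide_nonneg_nonneg sum_nonneg)
    from normalized_neg_ln_ge[OF this C(4)]
    have "ereal (g r - \<rho> * ln (16 * L) / n) \<le> normalized_neg_ln n (avg_list_error_prob n \<sigma> (L - 1) C)"
      using elim L1 \<gamma>_pos[OF r(2)] unfolding g_eq[OF r(2)] by simp
    moreover have "E - \<epsilon> \<le> g r - \<rho> * ln (16 * L) / n"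
      using elim(3) r(1) assms(8) by linarith
    ultimately have "ereal (E - \<epsilon>) \<le> normalized_neg_ln n (avg_list_error_prob n \<sigma> (L - 1) C)"
      by (meson ereal_less_eq(3) order_trans)
    moreover have "\<bar>code_rate n C - R\<bar> \<le> \<epsilon>" using C(2,3) elim(2) by linarith
    ultimately show ?case using C(1) by blast
  qed
qed

section \<open>Sequences of codes\<close>

text \<open>A diagonal sequence takes tolerances $1/(k+1)$ along increasing blocklengths. Its normalized error
exponents need not converge, but the extended reals are compact, so some subsequence does, and the
lower bound passes to its limit.\<close>
lemma exponent_achieved_of_eventually:
  fixes E R P \<sigma> :: real
  assumes "\<And>\<epsilon>. \<epsilon> > 0 \<Longrightarrow> \<forall>\<^sub>F n in sequentially. \<exists>C. awgn_code n P C \<and> \<bar>code_rate n C - R\<bar> \<le> \<epsilon> \<and>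
    ereal (E - \<epsilon>) \<le> normalized_neg_ln n (avg_list_error_prob n \<sigma> l C)"
  shows "\<exists>n C E'. codes_of_rate P R n C \<and> has_error_exponent \<sigma> l n C E' \<and> E' \<ge> ereal E"
proof -
  define Q where "Q k n C \<longleftrightarrow> awgn_code n P C \<and> \<bar>code_rate n C - R\<bar> \<le> 1 / Suc k \<and>
    ereal (E - 1 / Suc k) \<le> normalized_neg_ln n (avg_list_error_prob n \<sigma> l C)" for k n C
  have "\<forall>k. \<exists>N. \<forall>n\<ge>N. \<exists>C. Q k n C"
    using assms[of "1 / Suc _"] unfolding Q_def eventually_sequentially by simp
  then obtain N where "\<forall>k. \<forall>n\<ge>N k. \<exists>C. Q k n C" by metis
  then obtain D where D: "Q k n (D k n)" if "n \<ge> N k" for k n by metis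
  define n where "n k = (\<Sum>j\<le>k. Suc (N j))" for k
  have mono_n: "strict_mono n" by (rule strict_monoI_Suc) (simp add: n_def)
  have n_ge: "Suc (N k) \<le> n k" for k
    unfolding n_def by (rule member_le_sum[of k "{..k}" "\<lambda>j. Suc (N j)"]) auto
  define C where "C k = D k (n k)" for k
  have Q: "Q k (n k) (C k)" for k unfolding C_def using n_ge[of k] by (intro D) simp
  define e where "e k = normalized_neg_ln (n k) (avg_list_error_prob (n k) \<sigma> l (C k))" for k
  obtain E' r where r: "strict_mono r" "(e \<circ> r) \<longlonglongrightarrow> E'"
    using compact_complete_linorder[of e] by blast
  have inv: "(\<lambda>k. 1 / real (Suc k)) \<longlonglongrightarrow> 0"
    using LIMSEQ_inverse_real_of_nat by (simp add: inverse_eq_divide)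
  have "(\<lambda>k. code_rate (n k) (C k) - R) \<longlonglongrightarrow> 0"
    by (rule Lim_null_comparison[OF _ inv]) (use Q in \<open>auto simp: Q_def\<close>)
  then have "(\<lambda>k. code_rate (n k) (C k)) \<longlonglongrightarrow> R" by (simp add: LIM_zero_iff)
  then have rate: "(\<lambda>k. code_rate (n (r k)) (C (r k))) \<longlonglongrightarrow> R"
    using LIMSEQ_subseq_LIMSEQ[OF _ r(1)] by (fastforce simp: o_def)
  have "(\<lambda>k. E - 1 / Suc k) \<longlonglongrightarrow> E - 0" by (intro tendsto_intros inv)
  then have "(\<lambda>k. ereal (E - 1 / Suc k)) \<longlonglongrightarrow> ereal E" by simp
  then have "((\<lambda>k. ereal (E - 1 / Suc k)) \<circ> r) \<longlonglongrightarrow> ereal E" by (rule LIMSEQ_subseq_LIMSEQ[OF _ r(1)])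
  then have "ereal E \<le> E'"
    by (rule LIMSEQ_le[OF _ r(2)]) (use Q in \<open>auto simp: Q_def e_def\<close>)
  moreover have "codes_of_rate P R (n \<circ> r) (C \<circ> r)"
    unfolding codes_of_rate_def using rate Q n_ge strict_mono_o[OF mono_n r(1)]
    by (auto simp: Q_def intro: Suc_le_lessD less_le_trans[OF zero_less_Suc])
  moreover have "has_error_exponent \<sigma> l (n \<circ> r) (C \<circ> r) E'"
    using r(2) by (simp add: has_error_exponent_def e_def o_def)
  ultimately show ?thesis by blast
qed

text \<open>At rate zero the equation gives $t = 1$, where the parameter $\rho$ of the random coding argument is
infinite. One codeword per blocklength already has rate zero and never causes a list error.\<close>
lemma single_codeword_exponent:
  assumes "P > 0" and "l > 0"
  shows "\<exists>n C. codes_of_rate P 0 n C \<and> has_error_exponent \<sigma> l n C \<infinity>"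
proof (intro exI conjI)
  let ?C = "\<lambda>k. {\<lambda>i\<in>{..<Suc k}. 0 :: real}"
  have "awgn_code (Suc k) P (?C k)" for k
    using assms by (auto simp: awgn_code_def real_space_def L2_set_def)
  then show "codes_of_rate P 0 Suc ?C"
    by (simp add: codes_of_rate_def strict_mono_def code_rate_def)
  have "\<not> list_error_event n l {x} x g" for n x g
    using assms by (auto simp: list_error_event_def)
  then have "avg_list_error_prob n \<sigma> l {x} = 0" for n x
    by (simp add: avg_list_error_prob_def list_error_prob_def)
  then show "has_error_exponent \<sigma> l Suc ?C \<infinity>"
    by (simp add: has_error_exponent_def normalized_neg_ln_def)
qed

theorem mainTheorem5:
  fixes P \<sigma> snr R :: real and L :: nat
  assumes "P > 0" and "\<sigma> > 0" and "L \<ge> 2"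
    and "snr = P / \<sigma>\<^sup>2"
    and "0 \<le> R" and "R \<le> rate_x L snr"
  shows "\<exists>t. exponent_param L R t \<and> (\<forall>s. exponent_param L R s \<longrightarrow> s = t) \<and>
    (\<exists>n C E. codes_of_rate P R n C \<and> has_error_exponent \<sigma> (L - 1) n C E \<and>
       E \<ge> ereal (snr * (real L * t - 1) / (2 * real L * t)))"
proof -
  obtain t where t: "exponent_param L R t" "\<forall>s. exponent_param L R s \<longrightarrow> s = t"
    using exponent_param_ex1[OF assms(3,5)] by blast
  have "\<exists>n C E. codes_of_rate P R n C \<and> has_error_exponent \<sigma> (L - 1) n C E \<and>
       E \<ge> ereal (snr * (real L * t - 1) / (2 * real L * t))"
  proof (cases "R = 0")
    case True
    have "L - 1 > 0" using assms(3) by simp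
    then show ?thesis using single_codeword_exponent[OF assms(1), of "L - 1" \<sigma>] True by (metis ereal_less_eq(1))
  next
    case False
    then have "R > 0" using assms(5) by simp
    then show ?thesis
      using eventually_awgn_code_near_exponent[OF assms(1-4) _ assms(6) t(1)]
      by (intro exponent_achieved_of_eventually) blast
  qed
  then show ?thesis using t by blast
qed

end
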